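(* Let $n\ge 3$ and let $P$ be an $n$-gon (so $d=2$, with $n$ vertices and $m=n$ facets). Let $I^z=\{(i,j):\text{vertex } i \text{ lies on facet } j\}$ and set $\lambda_{ij}=\frac{2}{n}\sec^2\frac{\pi}{n}$ for all $(i,j)\notin I^z$. Then the semidefinite program $$\min_X\ \mathrm{tr}(X)-\sum_{(i,j)\notin I^z}\lambda_{ij}S_{ij}\quad\text{s.t.}\quad X=\begin{bmatrix}1 & \mathbb{1}_n^\top & \mathbb{1}_m^\top\\ \mathbb{1}_n & A & S\\ \mathbb{1}_m & S^\top & B\end{bmatrix}\succeq 0,\ \ S_{ij}=0 \text{ for }(i,j)\in I^z,\ \ A_{ii}=2\ (i=1,\ldots,n)$$ has an optimal solution $X$ of rank $3$ whose block $S$ satisfies $S_{ij}>0$ for all $(i,j)\notin I^z$; such a solution certifies the inscribability of the $n$-gon.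
   Context: A polytope is inscribable if some combinatorially equivalent polytope has all its vertices on a sphere. In the program, $A$ ($n\times n$) and $B$ ($m\times m$) are symmetric and $S$ is $n\times m$, all real; $\mathbb{1}_k$ is the all-ones vector. By the paper's characterization, a $d$-polytope is inscribable iff there is such a positive semidefinite $X$ of rank $d+1$ with constant diagonal in $A$, $S\ge 0$, and $S$ having exactly the zero pattern $I^z$. *)

theory Defs
  imports "HOL-Analysis.Analysis"
begin

definition vertices :: "'a::euclidean_space set \<Rightarrow> 'a set" where
  "vertices P = {x. x extreme_point_of P}"

definition facets :: "'a::euclidean_space set \<Rightarrow> 'a set set" where
  "facets P = {F. F facet_of P}"

text \<open>Combinatorial equivalence is isomorphism of face lattices; the faces include the empty
  face and the polytope itself.\<close>

definition combinatorially_equivalent ::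
    "'a::euclidean_space set \<Rightarrow> 'b::euclidean_space set \<Rightarrow> bool" where
  "combinatorially_equivalent P Q \<longleftrightarrow>
     (\<exists>\<phi>. bij_betw \<phi> {F. F face_of P} {G. G face_of Q} \<and>
          (\<forall>F G. F face_of P \<longrightarrow> G face_of P \<longrightarrow> (F \<subseteq> G \<longleftrightarrow> \<phi> F \<subseteq> \<phi> G)))"

definition inscribable :: "'a::euclidean_space set \<Rightarrow> bool" where
  "inscribable P \<longleftrightarrow>
     (\<exists>Q::'a set. polytope Q \<and> combinatorially_equivalent P Q \<and>
        (\<exists>c r. 0 < r \<and> vertices Q \<subseteq> sphere c r))"

definition polygon_with :: "nat \<Rightarrow> (real^2) set \<Rightarrow> bool" where
  "polygon_with n P \<longleftrightarrow> polytope P \<and> aff_dim P = 2 \<and> card (vertices P) = n"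

text \<open>Vertices and facets are labelled by finite index types, via \<open>v\<close> and \<open>F\<close>.\<close>

definition incidences :: "('n \<Rightarrow> 'a) \<Rightarrow> ('m \<Rightarrow> 'a set) \<Rightarrow> ('n \<times> 'm) set" where
  "incidences v F = {(i, j). v i \<in> F j}"

definition psd :: "real^'k^'k \<Rightarrow> bool" where
  "psd M \<longleftrightarrow> transpose M = M \<and> (\<forall>x. 0 \<le> x \<bullet> (M *v x))"

text \<open>The block matrix with rows \<open>(1, 1\<^sup>T, 1\<^sup>T)\<close>, \<open>(1, A, S)\<close>, \<open>(1, S\<^sup>T, B)\<close>.
  The index type \<open>unit + 'n + 'm\<close> associates to the right.\<close>

fun block_entry ::
    "real^'n^'n \<Rightarrow> real^'m^'n \<Rightarrow> real^'m^'m \<Rightarrow> unit + 'n + 'm \<Rightarrow> unit + 'n + 'm \<Rightarrow> real" where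
  "block_entry A S B (Inr (Inl i)) (Inr (Inl k)) = A $ i $ k"
| "block_entry A S B (Inr (Inl i)) (Inr (Inr j)) = S $ i $ j"
| "block_entry A S B (Inr (Inr j)) (Inr (Inl i)) = S $ i $ j"
| "block_entry A S B (Inr (Inr j)) (Inr (Inr l)) = B $ j $ l"
| "block_entry A S B (Inl _) _ = 1"
| "block_entry A S B _ (Inl _) = 1"

definition block_matrix ::
    "real^'n^'n \<Rightarrow> real^'m^'n \<Rightarrow> real^'m^'m \<Rightarrow> real^(unit + 'n + 'm)^(unit + 'n + 'm)" where
  "block_matrix A S B = (\<chi> r c. block_entry A S B r c)"

definition sdp_feasible ::
    "('n \<times> 'm) set \<Rightarrow> real^'n^'n \<Rightarrow> real^'m^'n \<Rightarrow> real^'m^'m \<Rightarrow> bool" where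
  "sdp_feasible I A S B \<longleftrightarrow>
     psd (block_matrix A S B) \<and> (\<forall>(i, j)\<in>I. S $ i $ j = 0) \<and> (\<forall>i. A $ i $ i = 2)"

definition sdp_objective ::
    "('n \<times> 'm) set \<Rightarrow> ('n \<Rightarrow> 'm \<Rightarrow> real) \<Rightarrow> real^'n^'n \<Rightarrow> real^'m^'n \<Rightarrow> real^'m^'m \<Rightarrow> real" where
  "sdp_objective I lam A S B =
     trace (block_matrix A S B) - (\<Sum>(i, j)\<in>- I. lam i j * S $ i $ j)"

definition sdp_optimal ::
    "('n \<times> 'm) set \<Rightarrow> ('n \<Rightarrow> 'm \<Rightarrow> real) \<Rightarrow> real^'n^'n \<Rightarrow> real^'m^'n \<Rightarrow> real^'m^'m \<Rightarrow> bool" where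
  "sdp_optimal I lam A S B \<longleftrightarrow> sdp_feasible I A S B \<and>
     (\<forall>A' S' B'. sdp_feasible I A' S' B' \<longrightarrow>
        sdp_objective I lam A S B \<le> sdp_objective I lam A' S' B')"

definition strict_solution ::
    "('n \<times> 'm) set \<Rightarrow> ('n \<Rightarrow> 'm \<Rightarrow> real) \<Rightarrow> real^'n^'n \<Rightarrow> real^'m^'n \<Rightarrow> real^'m^'m \<Rightarrow> bool" where
  "strict_solution I lam A S B \<longleftrightarrow>
     sdp_optimal I lam A S B \<and> rank (block_matrix A S B) = 3 \<and>
     (\<forall>i j. (i, j) \<notin> I \<longrightarrow> 0 < S $ i $ j)"

text \<open>The block \<open>A\<close> certifies inscribability of \<open>P\<close>: with the all-ones matrix subtracted, it is
  the Gram matrix of points on the unit sphere, and these are the vertices of a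
  polytope combinatorially equivalent to \<open>P\<close>.\<close>

definition certifies_inscribability :: "real^'n^'n \<Rightarrow> 'a::euclidean_space set \<Rightarrow> bool" where
  "certifies_inscribability A P \<longleftrightarrow>
     (\<exists>w :: 'n \<Rightarrow> 'a. (\<forall>i k. A $ i $ k = 1 + w i \<bullet> w k) \<and> (\<forall>i. norm (w i) = 1) \<and>
        vertices (convex hull (range w)) = range w \<and>
        combinatorially_equivalent P (convex hull (range w)))"

end

theory Submission
  imports Defs
begin

text \<open>A feasible \<open>X\<close> is the Gram matrix of vectors \<open>e\<close>, \<open>e + w\<^sub>i\<close>, \<open>e + u\<^sub>j\<close> with \<open>e\<close> a unit vector
  orthogonal to all \<open>w\<^sub>i\<close>, \<open>u\<^sub>j\<close>, the \<open>w\<^sub>i\<close> of length 1, and \<open>w\<^sub>i \<bullet> u\<^sub>j = -1\<close> on incident pairs. Number the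
  vertices and edges of the polygon cyclically and put \<open>s = sec(\<pi>/n)\<close>, \<open>\<mu> = s\<^sup>2/2\<close>. Up to a constant
  the objective is \<open>\<Sum>|u\<^sub>k|\<^sup>2 - (2s\<^sup>2/n) (\<Sum>w\<^sub>j) \<bullet> (\<Sum>u\<^sub>k)\<close>. With \<open>y\<^sub>j\<close> the vector \<open>w\<^sub>j\<close> minus the mean \<open>M\<close>, this
  exceeds \<open>n s\<^sup>2\<close> by
  \<open>\<Sum>|u\<^sub>k + \<mu> (y\<^sub>k + y\<^sub>k\<^sub>+\<^sub>1)|\<^sup>2 + n s\<^sup>2 |M|\<^sup>2 + (s\<^sup>2 \<Sum>|y\<^sub>j|\<^sup>2 - \<mu>\<^sup>2 \<Sum>|y\<^sub>k + y\<^sub>k\<^sub>+\<^sub>1|\<^sup>2)\<close>,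
  where the last bracket is nonnegative by the discrete Wirtinger inequality. The regular
  \<open>n\<close>-gon and its polar poles attain equality. Conversely, equality forces the \<open>w\<^sub>j\<close> into the
  lowest nonconstant Fourier mode, hence into a plane, and the sign pattern of \<open>S\<close> then identifies the facets
  of the hull of the \<open>w\<^sub>j\<close> with those of the polygon.\<close>

section \<open>Gram matrices\<close>

text \<open>Cholesky factorisation by induction on \<open>T\<close>: the pivot \<open>x\<close> is
  split off, the Schur complement is factored by the induction hypothesis, and the coordinate
  \<open>x\<close> carries the removed rank-one part. The support condition keeps that coordinate
  free, hence orthogonal to the vectors already built.\<close>

lemma gram_vectors_on:
  fixes M :: "'k::finite \<Rightarrow> 'k \<Rightarrow> real"
  assumes "finite T"
  shows "(\<And>i j. M i j = M j i) \<Longrightarrow> (\<And>c. 0 \<le> (\<Sum>i\<in>T. \<Sum>j\<in>T. c i * c j * M i j)) \<Longrightarrow>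
    \<exists>f::'k \<Rightarrow> real^'k. (\<forall>i\<in>T. \<forall>j\<in>T. f i \<bullet> f j = M i j) \<and> (\<forall>i. \<forall>x. x \<notin> T \<longrightarrow> f i $ x = 0)"
  using assms
proof (induction T arbitrary: M rule: finite_induct)
  case empty
  show ?case by (rule exI[of _ "\<lambda>_. 0"]) auto
next
  case (insert x T)
  define a where "a = M x x"
  have quad: "0 \<le> a * t\<^sup>2 + 2 * (\<Sum>i\<in>T. c i * M x i) * t + (\<Sum>i\<in>T. \<Sum>j\<in>T. c i * c j * M i j)" for c t
  proof -
    let ?d = "c(x := t)"
    have ne: "i \<in> T \<Longrightarrow> i \<noteq> x" for i using insert by auto
    have "0 \<le> (\<Sum>i\<in>insert x T. \<Sum>j\<in>insert x T. ?d i * ?d j * M i j)"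
      using insert.prems by blast
    also have "\<dots> = t * t * a + (\<Sum>j\<in>T. t * c j * M x j) +
        (\<Sum>i\<in>T. c i * t * M i x + (\<Sum>j\<in>T. c i * c j * M i j))"
      using insert ne by (simp add: a_def cong: sum.cong)
    also have "\<dots> = a * t\<^sup>2 + 2 * (\<Sum>i\<in>T. c i * M x i) * t + (\<Sum>i\<in>T. \<Sum>j\<in>T. c i * c j * M i j)"
      by (simp add: insert.prems(1)[of _ x] sum.distrib sum_distrib_left sum_distrib_right
          power2_eq_square algebra_simps sum_divide_distrib)
    finally show ?thesis .
  qed
  have a0: "0 \<le> a"
    using quad[of 1 "\<lambda>_. 0"] by simp
  \<comment> \<open>With a zero pivot the quadratic in \<open>t\<close> is affine; if its slope were
    nonzero, the chosen \<open>t\<close> would give it the value -1.\<close>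
  have lin0: "(\<Sum>i\<in>T. c i * M x i) = 0" if "a = 0" for c
  proof (rule ccontr)
    assume nz: "(\<Sum>i\<in>T. c i * M x i) \<noteq> 0"
    let ?L = "(\<Sum>i\<in>T. c i * M x i)" and ?Q = "(\<Sum>i\<in>T. \<Sum>j\<in>T. c i * c j * M i j)"
    have "0 \<le> 2 * ?L * (- (?Q + 1) / (2 * ?L)) + ?Q"
      using quad[of "- (?Q + 1) / (2 * ?L)" c] that by simp
    also have "\<dots> = -1" using nz by (simp add: field_simps)
    finally show False by simp
  qed
  have Mx0: "M x i = 0" if "a = 0" "i \<in> T" for i
    using lin0[OF that(1), of "\<lambda>k. if k = i then 1 else 0"] that insert(1)
    by (simp add: if_distrib[of "\<lambda>z. z * _"] cong: if_cong)
  \<comment> \<open>The Schur complement of the pivot. If \<open>a = 0\<close>, the quotient is 0 by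
    convention, which agrees with the vanishing of the row in \<open>Mx0\<close>.\<close>
  define M' where "M' i j = M i j - M x i * M x j / a" for i j
  have sym': "M' i j = M' j i" for i j by (simp add: M'_def insert.prems(1)[of i j])
  have psd': "0 \<le> (\<Sum>i\<in>T. \<Sum>j\<in>T. c i * c j * M' i j)" for c
  proof -
    let ?L = "(\<Sum>i\<in>T. c i * M x i)" and ?Q = "(\<Sum>i\<in>T. \<Sum>j\<in>T. c i * c j * M i j)"
    have "(\<Sum>i\<in>T. \<Sum>j\<in>T. c i * c j * M' i j) = ?Q - (\<Sum>i\<in>T. \<Sum>j\<in>T. (c i * M x i) * (c j * M x j)) / a"
      by (simp add: M'_def sum_subtractf algebra_simps sum_divide_distrib)
    also have "\<dots> = ?Q - ?L\<^sup>2 / a"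
      by (simp add: power2_eq_square sum_product)
    also have "\<dots> \<ge> 0"
    proof (cases "a = 0")
      case True then show ?thesis using quad[of 0 c] by simp
    next
      case False
      \<comment> \<open>\<open>- ?L / a\<close> minimizes the quadratic in \<open>t\<close>, and the
        minimum is the form of the Schur complement.\<close>
      have "a * (- ?L / a)\<^sup>2 + 2 * ?L * (- ?L / a) + ?Q = ?Q - ?L\<^sup>2 / a"
        using False by (simp add: field_simps power2_eq_square)
      then show ?thesis using quad[of "- ?L / a" c] by simp
    qed
    finally show ?thesis .
  qed
  obtain f' :: "'k \<Rightarrow> real^'k" where f': "\<And>i j. i \<in> T \<Longrightarrow> j \<in> T \<Longrightarrow> f' i \<bullet> f' j = M' i j"
    "\<And>i y. y \<notin> T \<Longrightarrow> f' i $ y = 0"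
    using insert.IH[of M', OF sym' psd'] by blast
  define f where "f i = (if i = x then 0 else f' i) + (M x i / sqrt a) *\<^sub>R axis x 1" for i
  have fx: "f' i \<bullet> axis x 1 = 0" "axis x 1 \<bullet> f' i = 0" for i
    using f'(2)[of x i] insert by (simp_all add: inner_axis inner_commute[of "axis x 1"])
  have sq: "M x i * M x j / (sqrt a * sqrt a) = M x i * M x j / a" for i j
    using a0 by simp
  have "f i \<bullet> f j = M i j" if "i \<in> insert x T" "j \<in> insert x T" for i j
  proof -
    have 1: "f i \<bullet> f j = (if i = x \<or> j = x then 0 else f' i \<bullet> f' j) + M x i * M x j / a"
      using sq a0 by (simp add: f_def inner_add_left inner_add_right fx inner_axis_axis mult.commute)
    have 2: "M x i * M x j / a = M i j" if "i = x \<or> j = x"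
    proof -
      have M0: "M x k = 0" if "a = 0" "k = i \<or> k = j" for k
        using that \<open>i \<in> _\<close> \<open>j \<in> _\<close> Mx0 by (auto simp: a_def)
      have "M i x = M x i" by (rule insert.prems(1))
      then show ?thesis using that M0[of i] M0[of j] by (cases "a = 0") (auto simp: a_def)
    qed
    show ?thesis using 1 2 f'(1)[of i j] that by (auto simp: M'_def)
  qed
  moreover have "f i $ y = 0" if "y \<notin> insert x T" for i y
    using that f'(2)[of y i] by (auto simp: f_def axis_def)
  ultimately show ?case by blast
qed

lemma psd_imp_gram:
  fixes M :: "real^'k^'k"
  assumes "psd M"
  obtains f :: "'k::finite \<Rightarrow> real^'k" where "\<And>i j. M $ i $ j = f i \<bullet> f j"
proof -
  have "transpose M = M" using assms by (simp add: psd_def)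
  then have "transpose M $ j $ i = M $ j $ i" for i j
    by simp
  then have sym: "M $ i $ j = M $ j $ i" for i j
    by (simp add: transpose_def)
  have "0 \<le> (\<Sum>i\<in>UNIV. \<Sum>j\<in>UNIV. c i * c j * M $ i $ j)" for c
  proof -
    have "0 \<le> (\<chi> i. c i) \<bullet> (M *v (\<chi> i. c i))" using assms by (simp add: psd_def)
    then show ?thesis
      by (simp add: inner_vec_def matrix_vector_mult_def sum_distrib_left mult_ac)
  qed
  from gram_vectors_on[of UNIV "\<lambda>i j. M $ i $ j", OF finite sym this]
  obtain f :: "'k \<Rightarrow> real^'k" where "\<forall>i\<in>UNIV. \<forall>j\<in>UNIV. f i \<bullet> f j = M $ i $ j"
    by blast
  then show ?thesis by (intro that[of f]) simp
qed

lemma gram_quadratic_form: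
  fixes M :: "real^'k^'k" and g :: "'k::finite \<Rightarrow> 'a::real_inner"
  assumes "\<And>r c. M $ r $ c = g r \<bullet> g c"
  shows "x \<bullet> (M *v x) = (norm (\<Sum>r\<in>UNIV. x $ r *\<^sub>R g r))\<^sup>2"
  by (simp add: inner_vec_def matrix_vector_mult_def assms power2_norm_eq_inner inner_sum_left
      inner_sum_right sum_distrib_left inner_commute mult_ac)

lemma gram_imp_psd:
  fixes M :: "real^'k^'k" and g :: "'k::finite \<Rightarrow> 'a::real_inner"
  assumes "\<And>r c. M $ r $ c = g r \<bullet> g c"
  shows "psd M"
  using gram_quadratic_form[of M g] assms
  by (simp add: psd_def transpose_def vec_eq_iff inner_commute)

text \<open>The rows of \<open>M\<close> are the images of the vectors \<open>g r\<close> under the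
  map taking \<open>z\<close> to its inner products with all \<open>g c\<close>. That map is
  injective because the \<open>g c\<close> span the space.\<close>

lemma rank_gram:
  fixes M :: "real^'k^'k" and g :: "'k::finite \<Rightarrow> 'a::euclidean_space"
  assumes M: "\<And>r c. M $ r $ c = g r \<bullet> g c" and sp: "span (range g) = UNIV"
  shows "rank M = DIM('a)"
proof -
  define L where "L z = (\<chi> c. z \<bullet> g c)" for z
  have lin: "linear L"
    by (rule linearI) (simp_all add: L_def vec_eq_iff inner_add_left)
  have "z = 0" if "L z = 0" for z
  proof -
    have "z \<bullet> g c = 0" for c using that by (simp add: L_def vec_eq_iff)
    then have "orthogonal z z"
      using sp by (intro orthogonal_to_span[of z "range g"]) (auto simp: orthogonal_def)
    then show ?thesis by (simp add: orthogonal_self)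
  qed
  then have inj: "inj L" using lin by (simp add: linear_injective_0)
  have "rows M = L ` range g"
    by (auto simp: rows_def row_def L_def M vec_eq_iff image_def)
  then have "rank M = dim (span (L ` range g))"
    by (simp add: row_rank_def)
  also have "\<dots> = dim (L ` UNIV)"
    using lin sp by (simp only: linear_span_image)
  also have "\<dots> = DIM('a)"
    using inj lin by (subst dim_image_eq) auto
  finally show ?thesis .
qed

section \<open>The discrete Wirtinger inequality\<close>

text \<open>A geometric sum of powers of an \<open>n\<close>-th root of unity, which equals 1
  exactly if \<open>n\<close> divides \<open>m\<close>.\<close>

lemma sum_cis_multiples:
  fixes m :: int
  assumes "0 < n"
  shows "(\<Sum>k<n. cis (2 * pi * real k * m / n)) = (if int n dvd m then of_nat n else 0)"
proof -
  define z where "z = cis (2 * pi * m / n)"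
  have zk: "cis (2 * pi * real k * m / n) = z ^ k" for k
    unfolding z_def Complex.DeMoivre by (rule arg_cong[of _ _ cis]) simp
  have z1: "z = 1 \<longleftrightarrow> int n dvd m"
  proof -
    have "z = 1 \<longleftrightarrow> cos (2 * pi * m / n) = 1"
      by (auto simp: z_def complex_eq_iff dest: cos_one_sin_zero)
    also have "\<dots> \<longleftrightarrow> (\<exists>x::int. 2 * pi * m / n = x * 2 * pi)"
      by (simp add: cos_one_2pi_int)
    also have "\<dots> \<longleftrightarrow> (\<exists>x::int. real_of_int m = x * n)"
      using assms by (simp add: field_simps)
    also have "\<dots> \<longleftrightarrow> (\<exists>x::int. m = x * int n)"
      by (metis of_int_eq_iff of_int_mult of_int_of_nat_eq)
    also have "\<dots> \<longleftrightarrow> int n dvd m" by (auto simp: dvd_def mult.commute)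
    finally show ?thesis .
  qed
  have "z ^ n = cis (2 * pi * m)"
    using assms by (simp add: z_def Complex.DeMoivre)
  then have zn: "z ^ n = 1"
    by (metis cis_2pi cis_multiple_2pi Ints_of_int)
  show ?thesis unfolding zk
    using z1 zn by (cases "z = 1") (simp_all add: sum_gp_strict)
qed

lemma sum_cos_multiples:
  fixes m :: int
  assumes "0 < n"
  shows "(\<Sum>k<n. cos (2 * pi * real k * m / n)) = (if int n dvd m then real n else 0)"
  using arg_cong[OF sum_cis_multiples[OF assms], of Re m] by (simp split: if_splits)

lemma sum_sin_multiples:
  fixes m :: int
  assumes "0 < n"
  shows "(\<Sum>k<n. sin (2 * pi * real k * m / n)) = 0"
  using arg_cong[OF sum_cis_multiples[OF assms], of Im m] by (simp split: if_splits)

lemma int_dvd_diff_less_iff: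
  assumes "i < n" "j < n"
  shows "int n dvd (int i - int j) \<longleftrightarrow> i = j"
  using assms by (metis mod_eq_dvd_iff mod_pos_pos_trivial of_nat_0_le_iff of_nat_less_iff of_nat_eq_iff)

lemma int_dvd_Suc_diff_less_iff:
  assumes "i < n" "j < n"
  shows "int n dvd (int i + 1 - int j) \<longleftrightarrow> j = Suc i mod n"
proof -
  have "int n dvd (int i + 1 - int j) \<longleftrightarrow> int (Suc i) mod int n = int j mod int n"
    by (simp add: mod_eq_dvd_iff add.commute)
  also have "\<dots> \<longleftrightarrow> Suc i mod n = j"
    using assms by (metis mod_less of_nat_eq_iff zmod_int)
  finally show ?thesis by auto
qed

section \<open>Cyclic sequences and their Fourier coefficients\<close>

lemma sum_shift_mod:
  assumes "0 < n"
  shows "(\<Sum>j<n. f (Suc j mod n)) = (\<Sum>j<n. f j)"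
proof -
  obtain m where n: "n = Suc m" using assms by (cases n) auto
  have "(\<Sum>j<n. f (Suc j mod n)) = (\<Sum>j<m. f (Suc j)) + f 0"
    by (simp add: n)
  also have "\<dots> = (\<Sum>j<n. f j)"
    by (simp only: n sum.lessThan_Suc_shift add.commute)
  finally show ?thesis .
qed

text \<open>The sequence takes values in a real space, so its Fourier coefficient at frequency
  \<open>k\<close> is kept as two vectors, a cosine and a sine part.\<close>

definition dft_cos :: "nat \<Rightarrow> (nat \<Rightarrow> 'a::real_inner) \<Rightarrow> nat \<Rightarrow> 'a" where
  "dft_cos n w k = (\<Sum>j<n. cos (2 * pi * real k * real j / n) *\<^sub>R w j)"

definition dft_sin :: "nat \<Rightarrow> (nat \<Rightarrow> 'a::real_inner) \<Rightarrow> nat \<Rightarrow> 'a" where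
  "dft_sin n w k = (\<Sum>j<n. sin (2 * pi * real k * real j / n) *\<^sub>R w j)"

text \<open>The squared modulus of the Fourier coefficient, without normalization.\<close>

definition dft_energy :: "nat \<Rightarrow> (nat \<Rightarrow> 'a::real_inner) \<Rightarrow> nat \<Rightarrow> real" where
  "dft_energy n w k = (norm (dft_cos n w k))\<^sup>2 + (norm (dft_sin n w k))\<^sup>2"

lemma cos_diff_index:
  "cos (2 * pi * real k * real_of_int (int i - int j) / n) =
     cos (2 * pi * real k * real i / n) * cos (2 * pi * real k * real j / n) +
     sin (2 * pi * real k * real i / n) * sin (2 * pi * real k * real j / n)"
proof -
  have "2 * pi * real k * real_of_int (int i - int j) / n =
      2 * pi * real k * real i / n - 2 * pi * real k * real j / n"
    by (simp add: algebra_simps diff_divide_distrib)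
  then show ?thesis by (simp add: cos_diff)
qed

text \<open>The frequency is separated from the inner products, so that sums over \<open>k\<close>
  act on the cosines alone.\<close>

lemma dft_energy_eq:
  "dft_energy n w k =
     (\<Sum>i<n. \<Sum>j<n. cos (2 * pi * real k * real_of_int (int i - int j) / n) * (w i \<bullet> w j))"
  unfolding cos_diff_index
  by (simp add: dft_energy_def dft_cos_def dft_sin_def power2_norm_eq_inner inner_sum_left
      inner_sum_right sum.distrib[symmetric] sum_distrib_left algebra_simps inner_commute)

text \<open>Parseval's identity: summing the cosines over \<open>k\<close> removes all pairs with
  \<open>i \<noteq> j\<close>.\<close>

lemma sum_dft_energy:
  assumes "0 < n"
  shows "(\<Sum>k<n. dft_energy n w k) = n * (\<Sum>j<n. (norm (w j))\<^sup>2)"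
proof -
  have "(\<Sum>k<n. dft_energy n w k) =
      (\<Sum>i<n. \<Sum>j<n. (\<Sum>k<n. cos (2 * pi * real k * real_of_int (int i - int j) / n)) * (w i \<bullet> w j))"
    unfolding dft_energy_eq sum_distrib_right
    by (subst sum.swap, rule sum.cong[OF refl], rule sum.swap)
  also have "\<dots> = (\<Sum>i<n. \<Sum>j<n. if j = i then n * (w i \<bullet> w j) else 0)"
    unfolding sum_cos_multiples[OF assms]
    by (intro sum.cong refl) (auto simp: int_dvd_diff_less_iff)
  also have "\<dots> = n * (\<Sum>j<n. (norm (w j))\<^sup>2)"
    by (simp add: sum_distrib_left power2_norm_eq_inner)
  finally show ?thesis .
qed

text \<open>The cyclic shift multiplies the coefficient at frequency \<open>k\<close> by a unit
  complex number with real part \<open>cos (2 * pi * k / n)\<close>. Concretely, the weight moves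
  the index difference by one in either direction, and orthogonality leaves neighbouring
  pairs.\<close>

lemma sum_cos_dft_energy:
  assumes "0 < n"
  shows "(\<Sum>k<n. cos (2 * pi * real k / n) * dft_energy n w k) = n * (\<Sum>j<n. w j \<bullet> w (Suc j mod n))"
proof -
  let ?c = "\<lambda>m::int. \<Sum>k<n. cos (2 * pi * real k * real_of_int m / n)"
  \<comment> \<open>Product to sum; the two terms are written so that exchanging \<open>i\<close>
    and \<open>j\<close> swaps them, and both contribute the same sum.\<close>
  have cc: "cos (2 * pi * real k / n) * cos (2 * pi * real k * real_of_int (int i - int j) / n) =
     (cos (2 * pi * real k * real_of_int (int i + 1 - int j) / n) +
      cos (2 * pi * real k * real_of_int (int j + 1 - int i) / n)) / 2" for k i j
  proof -
    have 1: "2 * pi * real k * real_of_int (int i + 1 - int j) / n =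
        2 * pi * real k / n + 2 * pi * real k * real_of_int (int i - int j) / n"
      by (simp add: algebra_simps add_divide_distrib diff_divide_distrib)
    have 2: "2 * pi * real k * real_of_int (int j + 1 - int i) / n =
        2 * pi * real k / n - 2 * pi * real k * real_of_int (int i - int j) / n"
      by (simp add: algebra_simps add_divide_distrib diff_divide_distrib)
    show ?thesis unfolding 1 2 by (simp add: cos_add cos_diff)
  qed
  have half: "(\<Sum>i<n. \<Sum>j<n. ?c (int i + 1 - int j) * (w i \<bullet> w j)) = n * (\<Sum>j<n. w j \<bullet> w (Suc j mod n))"
  proof -
    have "(\<Sum>i<n. \<Sum>j<n. ?c (int i + 1 - int j) * (w i \<bullet> w j)) =
        (\<Sum>i<n. \<Sum>j<n. if j = Suc i mod n then n * (w i \<bullet> w j) else 0)"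
      unfolding sum_cos_multiples[OF assms]
      by (intro sum.cong refl) (auto simp: int_dvd_Suc_diff_less_iff)
    also have "\<dots> = (\<Sum>i<n. n * (w i \<bullet> w (Suc i mod n)))"
      using assms by (intro sum.cong refl) simp
    finally show ?thesis by (simp add: sum_distrib_left)
  qed
  have "(\<Sum>k<n. cos (2 * pi * real k / n) * dft_energy n w k) =
      (\<Sum>k<n. \<Sum>i<n. \<Sum>j<n. (cos (2 * pi * real k / n) *
         cos (2 * pi * real k * real_of_int (int i - int j) / n)) * (w i \<bullet> w j))"
    unfolding dft_energy_eq by (simp only: sum_distrib_left mult.assoc)
  also have "\<dots> = (\<Sum>i<n. \<Sum>j<n. \<Sum>k<n. (cos (2 * pi * real k / n) *
         cos (2 * pi * real k * real_of_int (int i - int j) / n)) * (w i \<bullet> w j))"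
    by (subst sum.swap, rule sum.cong[OF refl], rule sum.swap)
  also have "\<dots> = (\<Sum>i<n. \<Sum>j<n. ?c (int i + 1 - int j) * (w i \<bullet> w j) / 2 +
      ?c (int j + 1 - int i) * (w j \<bullet> w i) / 2)"
    unfolding cc sum_distrib_right sum_divide_distrib sum.distrib[symmetric]
    by (intro sum.cong refl) (simp add: inner_commute field_simps)
  also have "\<dots> = (\<Sum>i<n. \<Sum>j<n. ?c (int i + 1 - int j) * (w i \<bullet> w j)) / 2 +
      (\<Sum>i<n. \<Sum>j<n. ?c (int j + 1 - int i) * (w j \<bullet> w i)) / 2"
    by (simp only: sum.distrib sum_divide_distrib)
  also have "(\<Sum>i<n. \<Sum>j<n. ?c (int j + 1 - int i) * (w j \<bullet> w i)) =
      (\<Sum>i<n. \<Sum>j<n. ?c (int i + 1 - int j) * (w i \<bullet> w j))"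
    by (rule sum.swap)
  finally show ?thesis unfolding half by simp
qed

lemma dft_inversion:
  assumes "j < n"
  shows "real n *\<^sub>R w j = (\<Sum>k<n. cos (2 * pi * real k * real j / n) *\<^sub>R dft_cos n w k +
      sin (2 * pi * real k * real j / n) *\<^sub>R dft_sin n w k)"
proof -
  have "(\<Sum>k<n. cos (2 * pi * real k * real j / n) *\<^sub>R dft_cos n w k +
      sin (2 * pi * real k * real j / n) *\<^sub>R dft_sin n w k) =
      (\<Sum>k<n. \<Sum>i<n. cos (2 * pi * real k * real_of_int (int j - int i) / n) *\<^sub>R w i)"
    unfolding cos_diff_index dft_cos_def dft_sin_def
    by (simp add: scaleR_sum_right sum.distrib[symmetric] scaleR_add_left)
  also have "\<dots> = (\<Sum>i<n. (\<Sum>k<n. cos (2 * pi * real k * real_of_int (int j - int i) / n)) *\<^sub>R w i)"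
    by (subst sum.swap) (simp only: scaleR_sum_left)
  also have "\<dots> = (\<Sum>i<n. if i = j then real n *\<^sub>R w i else 0)"
  proof -
    have n: "0 < n" using assms by simp
    show ?thesis unfolding sum_cos_multiples[OF n]
      using assms by (intro sum.cong refl) (auto simp: int_dvd_diff_less_iff)
  qed
  also have "\<dots> = real n *\<^sub>R w j" using assms by simp
  finally show ?thesis by simp
qed

text \<open>The interval from \<open>a\<close> to \<open>2 * pi - a\<close> is symmetric about
  \<open>pi\<close>; a point beyond \<open>pi\<close> is reflected into the range where cosine
  decreases.\<close>

lemma cos_less_cos:
  assumes "0 \<le> a" "a < t" "t < 2 * pi - a"
  shows "cos t < cos a"
proof (cases "t \<le> pi")
  case True then show ?thesis using assms cos_monotone_0_pi by blast
next
  case False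
  have "cos (2 * pi - t) < cos a" using assms False by (intro cos_monotone_0_pi) auto
  then show ?thesis by (simp add: cos_diff)
qed

text \<open>In Fourier space the defect is a sum of energies with weights
  \<open>cos (2 * pi / n) - cos (2 * pi * k / n)\<close>. The only negative weight is at
  \<open>k = 0\<close>, where the energy vanishes because the sequence sums to zero. The weight is
  zero exactly at \<open>k = 1\<close> and \<open>k = n - 1\<close>, so only these frequencies
  survive equality.\<close>

lemma
  fixes w :: "nat \<Rightarrow> 'a::real_inner"
  assumes n: "3 \<le> n" and zero: "(\<Sum>j<n. w j) = 0"
  shows discrete_wirtinger:
      "(\<Sum>j<n. (norm (w j + w (Suc j mod n)))\<^sup>2) \<le> 4 * (cos (pi / n))\<^sup>2 * (\<Sum>j<n. (norm (w j))\<^sup>2)"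
    and discrete_wirtinger_eq:
      "(\<Sum>j<n. (norm (w j + w (Suc j mod n)))\<^sup>2) = 4 * (cos (pi / n))\<^sup>2 * (\<Sum>j<n. (norm (w j))\<^sup>2) \<Longrightarrow>
       \<exists>p q. \<forall>j<n. w j = cos (2 * pi * real j / n) *\<^sub>R p + sin (2 * pi * real j / n) *\<^sub>R q"
proof -
  let ?E = "dft_energy n w"
  let ?L = "\<Sum>j<n. (norm (w j + w (Suc j mod n)))\<^sup>2" and ?N = "\<Sum>j<n. (norm (w j))\<^sup>2"
  have L: "?L = 2 * ?N + 2 * (\<Sum>j<n. w j \<bullet> w (Suc j mod n))"
  proof -
    have "?L = (\<Sum>j<n. (norm (w j))\<^sup>2) + (\<Sum>j<n. (norm (w (Suc j mod n)))\<^sup>2) + 2 * (\<Sum>j<n. w j \<bullet> w (Suc j mod n))"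
      by (simp add: power2_norm_eq_inner inner_add_left inner_add_right inner_commute sum.distrib sum_distrib_left)
    moreover have "(\<Sum>j<n. (norm (w (Suc j mod n)))\<^sup>2) = ?N"
      using n by (intro sum_shift_mod) auto
    ultimately show ?thesis by simp
  qed
  have c4: "4 * (cos (pi / n))\<^sup>2 = 2 + 2 * cos (2 * pi / n)"
    using cos_double_cos[of "pi / n"] by simp
  have "real n * (4 * (cos (pi / n))\<^sup>2 * ?N - ?L) = 2 * (cos (2 * pi / n) * (real n * ?N)) - 2 * (real n * (\<Sum>j<n. w j \<bullet> w (Suc j mod n)))"
    unfolding L c4 by (simp add: algebra_simps)
  also have "\<dots> = 2 * (\<Sum>k<n. (cos (2 * pi / n) - cos (2 * pi * real k / n)) * ?E k)"
  proof -
    have "(\<Sum>k<n. (cos (2 * pi / n) - cos (2 * pi * real k / n)) * ?E k) =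
        cos (2 * pi / n) * (\<Sum>k<n. ?E k) - (\<Sum>k<n. cos (2 * pi * real k / n) * ?E k)"
      by (simp add: left_diff_distrib sum_subtractf sum_distrib_left)
    moreover have "0 < n" using n by simp
    ultimately show ?thesis
      by (simp only: sum_dft_energy sum_cos_dft_energy right_diff_distrib)
  qed
  finally have id: "real n * (4 * (cos (pi / n))\<^sup>2 * ?N - ?L) =
      2 * (\<Sum>k<n. (cos (2 * pi / n) - cos (2 * pi * real k / n)) * ?E k)" .
  have E0: "?E 0 = 0" using zero by (simp add: dft_energy_def dft_cos_def dft_sin_def)
  have Ege: "0 \<le> ?E k" for k by (simp add: dft_energy_def)
  have refl': "2 * pi * real (n - Suc 0) / n = 2 * pi - 2 * pi / n"
    using n by (simp add: of_nat_diff field_simps)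
  have clast: "cos (2 * pi * real (n - Suc 0) / n) = cos (2 * pi / n)"
    unfolding refl' by (simp add: cos_diff)
  have split: "k = 0 \<or> k = 1 \<or> k = n - 1 \<or> 1 < k \<and> k + 1 < n" if "k < n" for k
    using that by linarith
  have cless: "cos (2 * pi * real k / n) < cos (2 * pi / n)" if "1 < k" "k + 1 < n" for k
  proof (rule cos_less_cos)
    have "real k + 1 < real n" using that by linarith
    then have "2 * pi * (real k + 1) < 2 * pi * n" by simp
    then have "2 * pi * (real k + 1) / n < 2 * pi"
      using that by (subst pos_divide_less_eq) auto
    then show "2 * pi * real k / n < 2 * pi - 2 * pi / n"
      by (simp add: ring_distribs add_divide_distrib)
  qed (use that in \<open>auto simp: divide_strict_right_mono\<close>)
  have trm: "0 \<le> (cos (2 * pi / n) - cos (2 * pi * real k / n)) * ?E k" if "k < n" for k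
    using split[OF that] cless[of k] E0 Ege clast by auto
  have "0 \<le> real n * (4 * (cos (pi / n))\<^sup>2 * ?N - ?L)"
    unfolding id by (intro mult_nonneg_nonneg sum_nonneg trm) auto
  then show "?L \<le> 4 * (cos (pi / n))\<^sup>2 * ?N"
    using n by (simp add: zero_le_mult_iff)
  assume "?L = 4 * (cos (pi / n))\<^sup>2 * ?N"
  then have "(\<Sum>k<n. (cos (2 * pi / n) - cos (2 * pi * real k / n)) * ?E k) = 0"
    using id by simp
  then have tz: "(cos (2 * pi / n) - cos (2 * pi * real k / n)) * ?E k = 0" if "k < n" for k
    using that trm by (subst (asm) sum_nonneg_eq_0_iff) auto
  have Ez: "?E k = 0" if "k < n" "k \<noteq> 1" "k \<noteq> n - 1" for k
    using split[OF that(1)] tz[OF that(1)] cless[of k] E0 that by auto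
  have dz: "dft_cos n w k = 0" "dft_sin n w k = 0" if "k < n" "k \<noteq> 1" "k \<noteq> n - 1" for k
    using Ez[OF that] by (simp_all add: dft_energy_def add_nonneg_eq_0_iff)
  have arg: "2 * pi * real (n - 1) * real j / n = 2 * pi * real j - 2 * pi * real j / n" for j
    using n by (simp add: of_nat_diff field_simps)
  have cs: "cos (2 * pi * real (n - 1) * real j / n) = cos (2 * pi * real j / n)"
    "sin (2 * pi * real (n - 1) * real j / n) = - sin (2 * pi * real j / n)" for j
  proof -
    have "cos (2 * pi * real j) = 1" "sin (2 * pi * real j) = 0"
      using cos_2npi[of j] sin_2npi[of j] by (simp_all add: mult_ac)
    then show "cos (2 * pi * real (n - 1) * real j / n) = cos (2 * pi * real j / n)"
      "sin (2 * pi * real (n - 1) * real j / n) = - sin (2 * pi * real j / n)"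
      unfolding arg by (simp_all add: cos_diff sin_diff)
  qed
  \<comment> \<open>The frequencies 1 and \<open>n - 1\<close> are conjugate, so both contribute the
    same vector to the inversion formula; hence the factor 2 below.\<close>
  have sym: "dft_cos n w (n - 1) = dft_cos n w 1" "dft_sin n w (n - 1) = - dft_sin n w 1"
    unfolding dft_cos_def dft_sin_def cs by (simp_all add: sum_negf)
  have two: "real n *\<^sub>R w j = 2 *\<^sub>R (cos (2 * pi * real j / n) *\<^sub>R dft_cos n w 1 + sin (2 * pi * real j / n) *\<^sub>R dft_sin n w 1)"
    if "j < n" for j
  proof -
    let ?t = "\<lambda>k. cos (2 * pi * real k * real j / n) *\<^sub>R dft_cos n w k + sin (2 * pi * real k * real j / n) *\<^sub>R dft_sin n w k"
    have "real n *\<^sub>R w j = (\<Sum>k<n. ?t k)" using that by (rule dft_inversion)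
    \<comment> \<open>The two indices are distinct because \<open>3 \<le> n\<close>.\<close>
    also have "\<dots> = (\<Sum>k\<in>{1, n - 1}. ?t k)"
      using n dz by (intro sum.mono_neutral_right) auto
    also have "\<dots> = ?t 1 + ?t (n - 1)" using n by (simp del: One_nat_def)
    finally show ?thesis unfolding cs sym by (simp add: scaleR_2)
  qed
  then have "w j = cos (2 * pi * real j / n) *\<^sub>R ((2 / n) *\<^sub>R dft_cos n w 1) + sin (2 * pi * real j / n) *\<^sub>R ((2 / n) *\<^sub>R dft_sin n w 1)"
    if "j < n" for j
  proof -
    have "w j = (1 / n) *\<^sub>R (real n *\<^sub>R w j)" using n by simp
    then show ?thesis using two[OF that]
      by (simp add: scaleR_add_right mult_ac)
  qed
  then show "\<exists>p q. \<forall>j<n. w j = cos (2 * pi * real j / n) *\<^sub>R p + sin (2 * pi * real j / n) *\<^sub>R q"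
    by blast
qed

section \<open>Face structure of convex polygons\<close>

lemma polytope_eq_hull_vertices:
  assumes "polytope P"
  shows "P = convex hull vertices P"
  using Krein_Milman_Minkowski[of P] assms polytope_imp_compact polytope_imp_convex
  by (auto simp: vertices_def)

lemma finite_vertices: "polytope P \<Longrightarrow> finite (vertices P)"
  using finite_polyhedron_extreme_points[of P] polytope_imp_polyhedron
  by (auto simp: vertices_def)

lemma vertices_subset: "vertices P \<subseteq> P"
  by (auto simp: vertices_def extreme_point_of_def)

lemma vertices_face: "F face_of P \<Longrightarrow> vertices F = vertices P \<inter> F"
  by (auto simp: vertices_def extreme_point_of_face)

lemma face_eq_hull_vertices:
  assumes "polytope P" "F face_of P"
  shows "F = convex hull (vertices P \<inter> F)"
  using polytope_eq_hull_vertices[of F] face_of_polytope_polytope[of P F] assms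
  by (simp add: vertices_face)

text \<open>A vertex of \<open>P\<close> lying in a convex subset of \<open>P\<close> is extreme
  there too, and the extreme points of a hull are among its generators.\<close>

lemma vertices_Int_hull:
  assumes "convex P" "W \<subseteq> vertices P"
  shows "vertices P \<inter> convex hull W = W"
proof
  have "convex hull W \<subseteq> P"
    using assms vertices_subset[of P] by (meson hull_minimal order_trans)
  then have "x extreme_point_of convex hull W" if "x \<in> vertices P" "x \<in> convex hull W" for x
    using that by (auto simp: vertices_def extreme_point_of_def)
  then show "vertices P \<inter> convex hull W \<subseteq> W"
    using extreme_point_of_convex_hull by blast
  show "W \<subseteq> vertices P \<inter> convex hull W"
    using assms hull_subset[of W convex] by auto
qed

text \<open>A face is the hull of its vertices, so inclusion of faces is inclusion of their label
  sets. If both polytopes have the same family of label sets, matching equal sets is a lattice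
  isomorphism.\<close>

lemma combinatorially_equivalentI:
  fixes v :: "'n \<Rightarrow> 'a::euclidean_space" and w :: "'n \<Rightarrow> 'b::euclidean_space"
  assumes P: "polytope P" "bij_betw v UNIV (vertices P)"
    and Q: "polytope Q" "bij_betw w UNIV (vertices Q)"
    and eq: "(\<lambda>F. v -` F) ` {F. F face_of P} = (\<lambda>G. w -` G) ` {G. G face_of Q}"
  shows "combinatorially_equivalent P Q"
proof -
  have mono: "F \<subseteq> G \<longleftrightarrow> v -` F \<subseteq> v -` G"
    if "polytope P" "bij_betw v UNIV (vertices P)" "F face_of P" "G face_of P"
    for P F G and v :: "'n \<Rightarrow> 'c::euclidean_space"
  proof
    assume "v -` F \<subseteq> v -` G"
    moreover have "vertices P = range v" using that(2) by (simp add: bij_betw_def)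
    ultimately have "vertices P \<inter> F \<subseteq> vertices P \<inter> G" by auto
    then show "F \<subseteq> G"
      using face_eq_hull_vertices[OF that(1,3)] face_eq_hull_vertices[OF that(1,4)] hull_mono by metis
  qed auto
  have bP: "bij_betw (\<lambda>F. v -` F) {F. F face_of P} ((\<lambda>F. v -` F) ` {F. F face_of P})"
    using mono[OF P] by (intro inj_on_imp_bij_betw inj_onI) blast
  have bQ: "bij_betw (\<lambda>G. w -` G) {G. G face_of Q} ((\<lambda>F. v -` F) ` {F. F face_of P})"
    unfolding eq using mono[OF Q] by (intro inj_on_imp_bij_betw inj_onI) blast
  define \<phi> where "\<phi> = inv_into {G. G face_of Q} (\<lambda>G. w -` G) \<circ> (\<lambda>F. v -` F)"
  have b: "bij_betw \<phi> {F. F face_of P} {G. G face_of Q}"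
    unfolding \<phi>_def using bP bQ by (intro bij_betw_trans bij_betw_inv_into)
  have \<phi>: "w -` \<phi> F = v -` F" if "F face_of P" for F
  proof -
    have "v -` F \<in> (\<lambda>G. w -` G) ` {G. G face_of Q}" using that eq by blast
    then show ?thesis
      using f_inv_into_f[of "v -` F" "\<lambda>G. w -` G" "{G. G face_of Q}"] by (simp add: \<phi>_def)
  qed
  have "F \<subseteq> G \<longleftrightarrow> \<phi> F \<subseteq> \<phi> G" if "F face_of P" "G face_of P" for F G
  proof -
    have "\<phi> F face_of Q" "\<phi> G face_of Q" using b that by (auto simp: bij_betw_def)
    then show ?thesis using mono[OF P that] mono[OF Q] \<phi> that by metis
  qed
  then show ?thesis using b unfolding combinatorially_equivalent_def by blast
qed

text \<open>The faces are listed by dimension, from -1 to 2. Apart from the facets all label sets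
  are the same for every polygon, so comparing two labelled polygons reduces to their
  facets.\<close>

lemma face_vertex_sets_2dim:
  fixes v :: "'n \<Rightarrow> 'a::euclidean_space"
  assumes P: "polytope P" "bij_betw v UNIV (vertices P)" and dim: "aff_dim P = 2"
  shows "(\<lambda>F. v -` F) ` {F. F face_of P} =
     {{}, UNIV} \<union> range (\<lambda>i. {i}) \<union> (\<lambda>F. v -` F) ` facets P"
proof -
  have inj: "inj v" and vV: "v i \<in> vertices P" for i
    using P(2) by (auto simp: bij_betw_def)
  have vP: "v i \<in> P" for i using vV vertices_subset by blast
  have "v -` F \<in> {{}, UNIV} \<union> range (\<lambda>i. {i}) \<union> (\<lambda>F. v -` F) ` facets P"
    if F: "F face_of P" for F
  proof -
    have cP: "convex P" using P polytope_imp_convex by blast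
    have "aff_dim F \<ge> -1" by (rule aff_dim_geq)
    moreover have "aff_dim F < 2 \<or> F = P"
      using face_of_aff_dim_lt[OF cP F] dim by linarith
    ultimately consider "F = P" | "aff_dim F = -1" | "aff_dim F = 0" | "aff_dim F = 1"
      by linarith
    then show ?thesis
    proof cases
      case 1 then show ?thesis using vP by auto
    next
      case 2
      then have "F = {}" by (simp add: aff_dim_empty)
      then show ?thesis by simp
    next
      case 3
      then obtain a where a: "F = {a}" by (auto simp: aff_dim_eq_0)
      then have "a \<in> vertices P" using F by (simp add: vertices_def face_of_singleton)
      then obtain i where "a = v i" using P(2) by (auto simp: bij_betw_def)
      then have "v -` F = {i}" using a inj by (auto simp: inj_def)
      then show ?thesis by simp
    next
      case 4
      then have "F facet_of P" using F dim by (auto simp: facet_of_def)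
      then show ?thesis by (auto simp: facets_def)
    qed
  qed
  moreover have "{} \<in> (\<lambda>F. v -` F) ` {F. F face_of P}"
    by (rule image_eqI[of _ _ "{}"]) auto
  moreover have "UNIV \<in> (\<lambda>F. v -` F) ` {F. F face_of P}"
    using vP P by (intro image_eqI[of _ _ P]) (auto intro: face_of_refl polytope_imp_convex)
  moreover have "{i} \<in> (\<lambda>F. v -` F) ` {F. F face_of P}" for i
    using vV inj by (intro image_eqI[of _ _ "{v i}"])
      (auto simp: inj_def vertices_def face_of_singleton)
  ultimately show ?thesis
    by (auto simp: facets_def facet_of_imp_face_of)
qed

lemma vertices_1dim:
  assumes "polytope P" "aff_dim P = 1"
  obtains a b where "a \<noteq> b" "vertices P = {a, b}"
proof -
  have "P \<noteq> {}" using assms by auto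
  then obtain a b where ab: "P = closed_segment a b"
    using compact_convex_collinear_segment[of P] assms
    by (metis collinear_aff_dim order_refl polytope_imp_compact polytope_imp_convex)
  then have "a \<noteq> b" using assms by auto
  moreover have "vertices P = {a, b}"
    by (auto simp: vertices_def ab extreme_point_of_segment)
  ultimately show ?thesis using that by blast
qed

section \<open>Orientation of triples and the cyclic order of vertices\<close>

lemma vertices_not_collinear:
  assumes "convex P" "{a, b, c} \<subseteq> vertices P" "a \<noteq> b" "b \<noteq> c" "a \<noteq> c"
  shows "\<not> collinear {a, b, c}"
proof
  assume "collinear {a, b, c}"
  then consider "a \<in> closed_segment b c" | "b \<in> closed_segment c a" | "c \<in> closed_segment a b"
    by (auto simp: collinear_between_cases between_mem_segment)
  moreover have "x \<notin> closed_segment y z"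
    if "{x, y, z} \<subseteq> vertices P" "x \<noteq> y" "x \<noteq> z" for x y z
    using vertices_Int_hull[of P "{y, z}"] that assms(1) by (auto simp: segment_convex_hull)
  ultimately show False using assms by (metis insert_commute)
qed

text \<open>Twice the signed area of the triangle \<open>p q r\<close>, positive if it is traversed
  counterclockwise.\<close>

definition orient :: "real^2 \<Rightarrow> real^2 \<Rightarrow> real^2 \<Rightarrow> real" where
  "orient p q r = (q$1 - p$1) * (r$2 - p$2) - (q$2 - p$2) * (r$1 - p$1)"

lemma orient_rotate: "orient p q r = orient q r p"
  and orient_swap: "orient p q r = - orient p r q"
  by (simp_all add: orient_def algebra_simps)

text \<open>With zero area, \<open>r - p\<close> equals its own orthogonal projection onto
  \<open>q - p\<close>.\<close>

lemma orient_eq_0_imp_collinear: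
  assumes "orient p q r = 0"
  shows "collinear {p, q, r}"
proof (cases "q = p")
  case False
  define c where "c = ((r - p) \<bullet> (q - p)) / ((q - p) \<bullet> (q - p))"
  have nz: "(q - p) \<bullet> (q - p) \<noteq> 0" using False by simp
  have "((q - p) \<bullet> (q - p)) * ((r - p) $ i) = ((r - p) \<bullet> (q - p)) * ((q - p) $ i)" for i
  proof -
    have ring: "(s * s + t * t) * x = (x * s + y * t) * s \<and> (s * s + t * t) * y = (x * s + y * t) * t"
      if "s * y - t * x = 0" for s t x y :: real
      using that by algebra
    have "i = 1 \<or> i = 2" using exhaust_2 by auto
    then show ?thesis
      using ring[OF assms[unfolded orient_def]] by (auto simp: inner_vec_def sum_2)
  qed
  then have "((q - p) \<bullet> (q - p)) *\<^sub>R (r - p) = ((r - p) \<bullet> (q - p)) *\<^sub>R (q - p)"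
    by (simp add: vec_eq_iff)
  moreover have "r - p = (1 / ((q - p) \<bullet> (q - p))) *\<^sub>R (((q - p) \<bullet> (q - p)) *\<^sub>R (r - p))"
    using nz by simp
  ultimately have "r - p = c *\<^sub>R (q - p)"
    by (simp add: c_def)
  then have "collinear {0, q - p, r - p}"
    unfolding collinear_lemma by blast
  then show ?thesis
    using collinear_3[of q p r] by (simp add: insert_commute)
qed simp

text \<open>Otherwise the ratios of signed areas \<open>?u\<close>, \<open>?v\<close>,
  \<open>?w\<close> would be nonnegative barycentric coordinates of \<open>b\<close> in the triangle
  \<open>o' a c\<close>, contradicting that \<open>b\<close> is a vertex.\<close>

lemma orient_convex_position:
  assumes P: "convex P" "{o', a, b, c} \<subseteq> vertices P" and b: "b \<noteq> o'" "b \<noteq> a" "b \<noteq> c"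
    and pos: "0 < orient o' a b" "0 < orient o' b c" "0 < orient o' a c"
  shows "0 < orient a b c"
proof (rule ccontr)
  assume neg: "\<not> 0 < orient a b c"
  let ?D = "orient o' a c"
  let ?u = "- orient a b c / ?D" and ?v = "orient o' b c / ?D" and ?w = "orient o' a b / ?D"
  have sum: "- orient a b c + orient o' b c + orient o' a b = ?D"
    by (simp add: orient_def algebra_simps)
  have "?D * b $ i = - orient a b c * o' $ i + orient o' b c * a $ i + orient o' a b * c $ i" for i
  proof -
    have "i = 1 \<or> i = 2" using exhaust_2 by auto
    then show ?thesis by (auto simp: orient_def algebra_simps)
  qed
  then have "?D *\<^sub>R b = (- orient a b c) *\<^sub>R o' + orient o' b c *\<^sub>R a + orient o' a b *\<^sub>R c"
    by (simp add: vec_eq_iff)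
  then have "(1 / ?D) *\<^sub>R (?D *\<^sub>R b) = ?u *\<^sub>R o' + ?v *\<^sub>R a + ?w *\<^sub>R c"
    by (simp only: scaleR_add_right scaleR_scaleR) simp
  then have "b = ?u *\<^sub>R o' + ?v *\<^sub>R a + ?w *\<^sub>R c"
    using pos by simp
  moreover have "?u + ?v + ?w = 1"
    using sum pos by (simp only: add_divide_distrib[symmetric]) simp
  moreover have "0 \<le> ?u" "0 \<le> ?v" "0 \<le> ?w"
    using neg pos by (auto intro: divide_nonpos_pos)
  ultimately have "b \<in> convex hull {o', a, c}" unfolding convex_hull_3 by blast
  then show False using vertices_Int_hull[of P "{o', a, c}"] P b by auto
qed

text \<open>Sorting the vertices by the slope of the ray from a fixed vertex puts them in
  counterclockwise order.\<close>

lemma polytope_cyclic_order: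
  fixes P :: "(real^2) set"
  assumes P: "polytope P" and n: "card (vertices P) = n" "0 < n"
  obtains x where "bij_betw x {..<n} (vertices P)"
    "\<And>i j k. i < j \<Longrightarrow> j < k \<Longrightarrow> k < n \<Longrightarrow> 0 < orient (x i) (x j) (x k)"
proof -
  let ?V = "vertices P"
  have cP: "convex P" using P polytope_imp_convex by blast
  have fin: "finite ?V" using P by (rule finite_vertices)
  obtain o' where o: "o' \<in> ?V" using n by fastforce
  \<comment> \<open>A vertex is an exposed face, so some functional \<open>a\<close> is maximal on
    \<open>P\<close> only at \<open>o'\<close>. All rays from \<open>o'\<close> to other vertices
    then lie in an open half-plane.\<close>
  then have "{o'} face_of P" by (simp add: vertices_def face_of_singleton)
  then have "{o'} exposed_face_of P"
    using P by (simp add: exposed_face_of_polyhedron polytope_imp_polyhedron)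
  then obtain a b where ab: "P \<subseteq> {x. a \<bullet> x \<le> b}" "{o'} = P \<inter> {x. a \<bullet> x = b}"
    unfolding exposed_face_of_def by blast
  have pos: "0 < a \<bullet> (o' - x)" if "x \<in> ?V - {o'}" for x
  proof -
    have "x \<in> P" using that vertices_subset by blast
    then have "a \<bullet> x \<le> b" "a \<bullet> x \<noteq> b" using ab that by auto
    moreover have "a \<bullet> o' = b" using ab by blast
    ultimately show ?thesis by (simp add: inner_diff_right)
  qed
  \<comment> \<open>The tangent of the angle from \<open>- a\<close> to \<open>x - o'\<close>; it
    increases with the angle on the open half-plane.\<close>
  define f where "f x = (a$1 * (o' - x)$2 - a$2 * (o' - x)$1) / (a \<bullet> (o' - x))" for x
  have or: "(a \<bullet> a) * orient o' x y = (f y - f x) * ((a \<bullet> (o' - x)) * (a \<bullet> (o' - y)))"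
    if "x \<in> ?V - {o'}" "y \<in> ?V - {o'}" for x y
  proof -
    have "(f y - f x) * ((a \<bullet> (o' - x)) * (a \<bullet> (o' - y))) =
       (a$1 * (o' - y)$2 - a$2 * (o' - y)$1) * (a \<bullet> (o' - x)) -
       (a$1 * (o' - x)$2 - a$2 * (o' - x)$1) * (a \<bullet> (o' - y))"
      using pos[OF that(1)] pos[OF that(2)] by (simp add: f_def field_simps)
    also have "\<dots> = (a \<bullet> a) * orient o' x y"
      by (simp add: orient_def inner_vec_def sum_2 algebra_simps)
    finally show ?thesis by simp
  qed
  have mono: "0 < orient o' x y" if "x \<in> ?V - {o'}" "y \<in> ?V - {o'}" "f x < f y" for x y
  proof -
    have "0 < (a \<bullet> a) * orient o' x y"
      using or[OF that(1,2)] pos[OF that(1)] pos[OF that(2)] that(3) by simp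
    then show ?thesis
      using mult_nonneg_nonpos[OF inner_ge_zero[of a], of "orient o' x y"] by linarith
  qed
  have inj: "inj_on f (?V - {o'})"
  proof (rule inj_onI, rule ccontr)
    fix x y assume xy: "x \<in> ?V - {o'}" "y \<in> ?V - {o'}" "f x = f y" "x \<noteq> y"
    have "a \<noteq> 0" using pos[OF xy(1)] by auto
    then have "orient o' x y = 0" using or[OF xy(1,2)] xy(3) by simp
    then have "collinear {o', x, y}" by (rule orient_eq_0_imp_collinear)
    then show False using vertices_not_collinear[OF cP, of o' x y] xy o by auto
  qed
  define xs where "xs = sorted_list_of_set (f ` (?V - {o'}))"
  define g where "g = inv_into (?V - {o'}) f"
  have len: "length xs = n - 1"
    using inj fin o n by (simp add: xs_def card_image)
  have g: "bij_betw g (f ` (?V - {o'})) (?V - {o'})" "\<And>z. z \<in> f ` (?V - {o'}) \<Longrightarrow> f (g z) = z"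
    unfolding g_def using inj by (auto intro: bij_betw_inv_into inj_on_imp_bij_betw f_inv_into_f)
  have nth: "bij_betw ((!) xs) {..<n - 1} (f ` (?V - {o'}))"
    using fin len by (intro bij_betw_nth) (auto simp: xs_def)
  have inc: "xs ! i < xs ! j" if "i < j" "j < n - 1" for i j
    using that len by (intro sorted_wrt_nth_less[of "(<)"]) (auto simp: xs_def)
  \<comment> \<open>The base vertex takes position 0, so the sorted list of slopes is read with an
    offset of one.\<close>
  define x where "x i = (if i = 0 then o' else g (xs ! (i - 1)))" for i
  have b1: "bij_betw (\<lambda>i. i - 1) {1..<n} {..<n - 1}"
    by (rule bij_betwI[of _ _ _ Suc]) auto
  have "bij_betw (\<lambda>i. g (xs ! (i - 1))) {1..<n} (?V - {o'})"
    using bij_betw_trans[OF b1 bij_betw_trans[OF nth g(1)]] by (simp add: comp_def)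
  then have bx: "bij_betw x {1..<n} (?V - {o'})"
    by (subst bij_betw_cong[of _ _ "\<lambda>i. g (xs ! (i - 1))"]) (auto simp: x_def)
  have xV: "x i \<in> ?V - {o'}" if "0 < i" "i < n" for i
    using bx that by (auto simp: bij_betw_def)
  have ninj: "x i \<noteq> x j" if "0 < i" "i < j" "j < n" for i j
    using inj_on_eq_iff[OF bij_betw_imp_inj_on[OF bx], of i j] that by simp
  have "bij_betw x ({0} \<union> {1..<n}) ({o'} \<union> (?V - {o'}))"
    by (intro bij_betw_combine bx) (auto simp: x_def bij_betw_def)
  moreover have "{0} \<union> {1..<n} = {..<n}" "{o'} \<union> (?V - {o'}) = ?V" using n o by auto
  ultimately have bij: "bij_betw x {..<n} ?V" by simp
  have fx: "f (x i) < f (x j)" if "0 < i" "i < j" "j < n" for i j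
  proof -
    have *: "f (x i) = xs ! (i - 1)" if "0 < i" "i < n" for i
    proof -
      have "xs ! (i - 1) \<in> f ` (?V - {o'})" using nth that by (intro bij_betw_apply[OF nth]) auto
      then show ?thesis using that g(2) by (simp add: x_def)
    qed
    show ?thesis using that inc[of "i - 1" "j - 1"] by (simp add: *)
  qed
  have x0: "x 0 = o'" by (simp add: x_def)
  have o0: "0 < orient o' (x i) (x j)" if "0 < i" "i < j" "j < n" for i j
    using that by (intro mono xV fx) auto
  have "0 < orient (x i) (x j) (x k)" if "i < j" "j < k" "k < n" for i j k
  proof (cases "i = 0")
    case True then show ?thesis using o0[of j k] that x0 by simp
  next
    case False
    then have ijk: "0 < i" "i < j" "0 < j" "j < k" "j < n" "k < n" "i < k" "i < n" "0 < k"
      using that by auto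
    show ?thesis
    proof (rule orient_convex_position[OF cP])
      show "{o', x i, x j, x k} \<subseteq> ?V" "x j \<noteq> o'"
        using o xV[of i] xV[of j] xV[of k] ijk by auto
      show "x j \<noteq> x i" "x j \<noteq> x k"
        using ninj[of i j] ninj[of j k] ijk by auto
      show "0 < orient o' (x i) (x j)" "0 < orient o' (x j) (x k)" "0 < orient o' (x i) (x k)"
        using o0 ijk by auto
    qed
  qed
  then show ?thesis by (rule that[OF bij])
qed

text \<open>All other vertices lie strictly to the left of the line through two consecutive ones,
  which is therefore supporting. The line through two nonconsecutive vertices has vertices strictly
  on both sides and supports nothing.\<close>

lemma polygon_facets:
  fixes P :: "(real^2) set"
  assumes "polygon_with n P" "3 \<le> n"
  obtains x where "bij_betw x {..<n} (vertices P)"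
    "\<And>F. F facet_of P \<longleftrightarrow> (\<exists>i<n. F = convex hull {x i, x (Suc i mod n)})"
proof -
  have P: "polytope P" and dim: "aff_dim P = 2" and card: "card (vertices P) = n"
    using assms by (auto simp: polygon_with_def)
  have cP: "convex P" using P polytope_imp_convex by blast
  obtain x where bij: "bij_betw x {..<n} (vertices P)" and
    or: "\<And>i j k. i < j \<Longrightarrow> j < k \<Longrightarrow> k < n \<Longrightarrow> 0 < orient (x i) (x j) (x k)"
    using polytope_cyclic_order[OF P card] assms by auto
  have xV: "x i \<in> vertices P" if "i < n" for i using bij that by (auto simp: bij_betw_def)
  have xsurj: "\<exists>k<n. y = x k" if "y \<in> vertices P" for y
    using that bij_betw_imp_surj_on[OF bij] by auto
  have xinj: "x i = x j \<longleftrightarrow> i = j" if "i < n" "j < n" for i j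
    using bij that by (auto simp: bij_betw_def inj_on_def)
  have PV: "P = convex hull vertices P" using P by (rule polytope_eq_hull_vertices)
  have edge: "convex hull {x i, x (Suc i mod n)} facet_of P" if i: "i < n" for i
  proof -
    let ?j = "Suc i mod n"
    have j: "?j < n" "i \<noteq> ?j" using i assms by (auto simp: mod_Suc)
    \<comment> \<open>Rotating the triple puts its indices in increasing order; the closing edge
      from \<open>n - 1\<close> to 0 is the case \<open>Suc i = n\<close>.\<close>
    have pos: "0 < orient (x i) (x ?j) (x k)" if "k < n" "k \<noteq> i" "k \<noteq> ?j" for k
    proof (cases "Suc i = n")
      case True
      then show ?thesis using that or[of 0 k i] by (simp add: orient_rotate[of "x i"])
    next
      case False
      then show ?thesis using that i or[of i "Suc i" k] or[of k i "Suc i"]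
        by (cases "k < i") (auto simp: orient_rotate[of "x k"])
    qed
    \<comment> \<open>The edge vector turned left by a right angle, that is, the inner normal; its
      functional is the orientation up to a constant.\<close>
    define c :: "real^2" where "c = vector [x i $ 2 - x ?j $ 2, x ?j $ 1 - x i $ 1]"
    have oc: "orient (x i) (x ?j) y = c \<bullet> y - c \<bullet> x i" for y
      by (simp add: orient_def c_def inner_vec_def sum_2 algebra_simps)
    have oz: "orient (x i) (x ?j) (x i) = 0" "orient (x i) (x ?j) (x ?j) = 0"
      by (simp_all add: orient_def)
    have cV: "c \<bullet> x i \<le> c \<bullet> y" if "y \<in> vertices P" for y
    proof -
      obtain k where k: "k < n" "y = x k" using xsurj \<open>y \<in> vertices P\<close> by blast
      have "0 \<le> orient (x i) (x ?j) (x k)" using pos[of k] k oz by (cases "k = i \<or> k = ?j") auto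
      then show ?thesis using oc k by simp
    qed
    have "vertices P \<subseteq> {y. c \<bullet> x i \<le> c \<bullet> y}" using cV by blast
    then have "P \<subseteq> {y. c \<bullet> x i \<le> c \<bullet> y}"
      using PV convex_halfspace_ge[of "c \<bullet> x i" c] hull_minimal by (metis (mono_tags, lifting))
    then have F: "(P \<inter> {y. c \<bullet> y = c \<bullet> x i}) face_of P"
      using cP by (intro face_of_Int_supporting_hyperplane_ge) auto
    have "vertices P \<inter> (P \<inter> {y. c \<bullet> y = c \<bullet> x i}) = {x i, x ?j}"
    proof -
      have "y = x i \<or> y = x ?j" if "y \<in> vertices P" "c \<bullet> y = c \<bullet> x i" for y
      proof -
        obtain k where k: "k < n" "y = x k" using xsurj \<open>y \<in> vertices P\<close> by blast
        then show ?thesis using pos[of k] oc[of "x k"] that by auto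
      qed
      moreover have "c \<bullet> x ?j = c \<bullet> x i" using oc[of "x ?j"] oz by simp
      ultimately show ?thesis using xV i j vertices_subset by blast
    qed
    then have "convex hull {x i, x ?j} face_of P"
      using face_eq_hull_vertices[OF P F] F by simp
    moreover have "aff_dim (convex hull {x i, x ?j}) = 1"
      using xinj i j by (simp add: aff_dim_convex_hull)
    ultimately show ?thesis using dim by (auto simp: facet_of_def)
  qed
  have "\<exists>i<n. F = convex hull {x i, x (Suc i mod n)}" if F: "F facet_of P" for F
  proof -
    have Ff: "F face_of P" "aff_dim F = 1" using F dim by (auto simp: facet_of_def)
    then have "polytope F" using P face_of_polytope_polytope by blast
    then obtain a b where ab: "a \<noteq> b" "vertices F = {a, b}" using Ff vertices_1dim by blast
    then have ab': "vertices P \<inter> F = {a, b}" using vertices_face Ff by blast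
    then have Fab: "F = convex hull {a, b}" using face_eq_hull_vertices[OF P Ff(1)] by simp
    have "\<exists>i j. i < j \<and> j < n \<and> {a, b} = {x i, x j}"
    proof -
      have "a \<in> x ` {..<n}" "b \<in> x ` {..<n}" using ab' bij by (auto simp: bij_betw_def)
      then obtain i j where "i < n" "j < n" "a = x i" "b = x j" by auto
      moreover have "i < j \<or> j < i" using calculation ab by (metis linorder_neqE_nat)
      ultimately show ?thesis by (auto simp: insert_commute)
    qed
    then obtain i j where ij: "i < j" "j < n" "{a, b} = {x i, x j}" by blast
    have "F exposed_face_of P"
      using P Ff by (simp add: exposed_face_of_polyhedron polytope_imp_polyhedron)
    then obtain c d where cd: "P \<subseteq> {y. c \<bullet> y \<le> d}" "F = P \<inter> {y. c \<bullet> y = d}"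
      unfolding exposed_face_of_def by blast
    have xF: "x k \<in> F \<longleftrightarrow> k = i \<or> k = j" if "k < n" for k
    proof -
      have "x k \<in> F \<longleftrightarrow> x k \<in> {x i, x j}" using ab' xV[OF that] ij(3) by blast
      then show ?thesis using xinj[of k i] xinj[of k j] that ij by simp
    qed
    have cF: "c \<bullet> x i = d" "c \<bullet> x j = d" using xF[of i] xF[of j] ij cd by auto
    have cless: "c \<bullet> x k < d" if "k < n" "k \<noteq> i" "k \<noteq> j" for k
    proof -
      have "x k \<in> P" using xV[OF that(1)] vertices_subset by blast
      then show ?thesis using xF[of k] that cd by fastforce
    qed
    have "j = Suc i \<or> i = 0 \<and> Suc j = n"
    proof (rule ccontr)
      assume na: "\<not> (j = Suc i \<or> i = 0 \<and> Suc j = n)"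
      \<comment> \<open>Two witnesses on opposite sides: \<open>Suc i\<close> lies strictly between
        \<open>i\<close> and \<open>j\<close> in the cyclic order, and \<open>l\<close> lies outside
        that range.\<close>
      define l where "l = (if 0 < i then 0 else n - 1)"
      have l: "l < n" "l \<noteq> i" "l \<noteq> j" "0 < orient (x i) (x j) (x l)"
      proof -
        have "l < n \<and> l \<noteq> i \<and> l \<noteq> j \<and> 0 < orient (x i) (x j) (x l)"
        proof (cases "0 < i")
          case True
          then show ?thesis
            using ij or[of 0 i j] orient_rotate[of "x 0" "x i" "x j"] by (simp add: l_def)
        next
          case False
          then have "j < n - 1" using na ij by linarith
          then show ?thesis using False ij or[of i j "n - 1"] by (simp add: l_def)
        qed
        then show "l < n" "l \<noteq> i" "l \<noteq> j" "0 < orient (x i) (x j) (x l)" by auto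
      qed
      have k: "Suc i < n" "Suc i \<noteq> i" "Suc i \<noteq> j" "orient (x i) (x j) (x (Suc i)) < 0"
        using na ij or[of i "Suc i" j] orient_swap[of "x i" "x j" "x (Suc i)"] by simp_all
      define e where "e = x j - x i"
      \<comment> \<open>As \<open>c\<close> is normal to \<open>e\<close>, the value
        \<open>c \<bullet> y - d\<close> is the orientation of \<open>y\<close> times a fixed factor
        of sign \<open>t\<close>. It is negative at both witnesses, whose orientations differ in
        sign.\<close>
      define t where "t = e$1 * c$2 - e$2 * c$1"
      have ce: "c$1 * e$1 + c$2 * e$2 = 0"
        using cF by (simp add: e_def inner_vec_def sum_2 algebra_simps)
      have id: "(e \<bullet> e) * (c \<bullet> y - d) = t * orient (x i) (x j) y" for y
      proof -
        have "(e \<bullet> e) * (c \<bullet> (y - x i)) = (e$1 * c$2 - e$2 * c$1) * (e$1 * (y - x i)$2 - e$2 * (y - x i)$1)"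
        proof -
          have ring: "(s * s + s' * s') * (u * z + u' * z') = (s * u' - s' * u) * (s * z' - s' * z)"
            if "u * s + u' * s' = 0" for s s' u u' z z' :: real
            using that by algebra
          show ?thesis unfolding inner_vec_def sum_2 using ring[OF ce] by simp
        qed
        then show ?thesis using cF by (simp add: t_def orient_def e_def inner_diff_right)
      qed
      have "x j \<noteq> x i" using xinj[of j i] ij by auto
      then have ee: "0 < e \<bullet> e" by (simp add: e_def)
      have "(e \<bullet> e) * (c \<bullet> x l - d) < 0" "(e \<bullet> e) * (c \<bullet> x (Suc i) - d) < 0"
        using cless[of l] cless[of "Suc i"] l k ee by (auto intro: mult_pos_neg)
      then have "t * orient (x i) (x j) (x l) < 0" "t * orient (x i) (x j) (x (Suc i)) < 0"
        by (simp_all add: id)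
      then show False using l(4) k(4) by (auto simp: mult_less_0_iff)
    qed
    then show ?thesis
    proof
      assume "j = Suc i"
      then show ?thesis using Fab ij by (intro exI[of _ i]) auto
    next
      assume "i = 0 \<and> Suc j = n"
      then show ?thesis using Fab ij by (intro exI[of _ j]) (auto simp: insert_commute)
    qed
  qed
  then show ?thesis using that[OF bij] edge by blast
qed

section \<open>Cyclic labellings and inscribed polygons\<close>

lemma cyclic_pair_eq_iff:
  assumes "3 \<le> n" "i < n" "k < n"
  shows "{i, Suc i mod n} = {k, Suc k mod n} \<longleftrightarrow> i = k"
  using assms by (auto simp: doubleton_eq_iff mod_Suc split: if_splits)

text \<open>Replaces the arbitrary labels by a cyclic numbering of vertices and edges. It also shows
  that vertices and facets are equally many, since both are enumerated by the same index
  range.\<close>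

lemma polygon_labelling:
  fixes P :: "(real^2) set" and v :: "'n::finite \<Rightarrow> real^2" and F :: "'m::finite \<Rightarrow> (real^2) set"
  assumes n: "CARD('n) = n" "3 \<le> n" and P: "polygon_with n P"
    and v: "bij_betw v UNIV (vertices P)" and F: "bij_betw F UNIV (facets P)"
  obtains \<sigma> \<tau> where "bij_betw \<sigma> {..<n} (UNIV :: 'n set)" "bij_betw \<tau> {..<n} (UNIV :: 'm set)"
    "\<And>i k. i < n \<Longrightarrow> k < n \<Longrightarrow> v (\<sigma> i) \<in> F (\<tau> k) \<longleftrightarrow> i = k \<or> i = Suc k mod n"
proof -
  obtain x where x: "bij_betw x {..<n} (vertices P)"
    and fac: "\<And>F. F facet_of P \<longleftrightarrow> (\<exists>i<n. F = convex hull {x i, x (Suc i mod n)})"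
    using polygon_facets[OF P n(2)] by blast
  have cP: "convex P" using P polytope_imp_convex by (auto simp: polygon_with_def)
  let ?E = "\<lambda>k. convex hull {x k, x (Suc k mod n)}"
  have xV: "x k \<in> vertices P" "x (Suc k mod n) \<in> vertices P" if "k < n" for k
    using bij_betw_apply[OF x] that by auto
  have xE: "x i \<in> ?E k \<longleftrightarrow> i = k \<or> i = Suc k mod n" if "i < n" "k < n" for i k
  proof -
    have "x i \<in> ?E k \<longleftrightarrow> x i \<in> {x k, x (Suc k mod n)}"
      using vertices_Int_hull[OF cP, of "{x k, x (Suc k mod n)}"] xV[OF that(1)] xV[OF that(2)] by blast
    moreover have "Suc k mod n < n" using that by simp
    ultimately show ?thesis using x that by (auto simp: bij_betw_def inj_on_def)
  qed
  have "inj_on ?E {..<n}"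
  proof (rule inj_onI)
    fix i k assume ik: "i \<in> {..<n}" "k \<in> {..<n}" "?E i = ?E k"
    have "Suc i mod n < n" "Suc k mod n < n" using ik by auto
    then have "{i, Suc i mod n} = {k, Suc k mod n}"
      using ik xE[of _ i] xE[of _ k] by auto
    then show "i = k" using cyclic_pair_eq_iff[OF n(2)] ik by auto
  qed
  moreover have "?E ` {..<n} = facets P" using fac by (auto simp: facets_def)
  ultimately have E: "bij_betw ?E {..<n} (facets P)" by (simp add: bij_betw_def)
  define \<sigma> where "\<sigma> = inv_into UNIV v \<circ> x"
  define \<tau> where "\<tau> = inv_into UNIV F \<circ> ?E"
  have "v (\<sigma> i) = x i" if "i < n" for i
    using that v x by (auto simp: \<sigma>_def bij_betw_def intro!: f_inv_into_f)
  moreover have "F (\<tau> k) = ?E k" if "k < n" for k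
    using that F E unfolding \<tau>_def bij_betw_def comp_def by (intro f_inv_into_f) blast
  ultimately show ?thesis
    using that[of \<sigma> \<tau>] xE bij_betw_trans[OF x bij_betw_inv_into[OF v]]
      bij_betw_trans[OF E bij_betw_inv_into[OF F]] unfolding \<sigma>_def \<tau>_def by simp
qed

text \<open>Strict convexity of the ball: a point inside a segment is closer to the origin than one
  of the endpoints, so a unit vector is never inside a segment of the unit ball.\<close>

lemma convex_hull_unit_vectors_vertices:
  fixes w :: "'n::finite \<Rightarrow> 'a::euclidean_space"
  assumes "\<And>i. norm (w i) = 1"
  shows "vertices (convex hull range w) = range w"
proof
  show "vertices (convex hull range w) \<subseteq> range w"
    by (auto simp: vertices_def dest: extreme_point_of_convex_hull)
  have sub: "convex hull range w \<subseteq> cball 0 1"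
    using assms by (intro hull_minimal) (auto simp: dist_norm)
  show "range w \<subseteq> vertices (convex hull range w)"
  proof
    fix x assume x: "x \<in> range w"
    have "x \<notin> open_segment a b" if "a \<in> convex hull range w" "b \<in> convex hull range w" for a b
    proof
      assume *: "x \<in> open_segment a b"
      have "dist x 0 < dist a 0 \<or> dist x 0 < dist b 0"
        using dist_decreases_open_segment[OF *, of 0] by (simp add: dist_commute)
      then show False using sub that x assms by fastforce
    qed
    then show "x \<in> vertices (convex hull range w)"
      using x by (auto simp: vertices_def extreme_point_of_def hull_inc)
  qed
qed

text \<open>The vectors \<open>u j\<close> are the poles of the facets: the facet \<open>F j\<close> corresponds to the face
  of the inscribed polygon on the line \<open>w \<bullet> u j = -1\<close>. A count shows that there are no further
  facets.\<close>

lemma inscribed_polygon_equivalent: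
  fixes P :: "(real^2) set" and v :: "'n::finite \<Rightarrow> real^2" and F :: "'m::finite \<Rightarrow> (real^2) set"
    and w :: "'n \<Rightarrow> real^2" and u :: "'m \<Rightarrow> real^2"
  assumes n: "3 \<le> CARD('n)" and P: "polygon_with CARD('n) P"
    and v: "bij_betw v UNIV (vertices P)" and F: "bij_betw F UNIV (facets P)"
    and norm: "\<And>i. norm (w i) = 1"
    and zero: "\<And>i j. v i \<in> F j \<Longrightarrow> w i \<bullet> u j = -1"
    and pos: "\<And>i j. v i \<notin> F j \<Longrightarrow> -1 < w i \<bullet> u j"
  shows "combinatorially_equivalent P (convex hull range w)"
proof -
  let ?n = "CARD('n)" and ?Q = "convex hull range w"
  obtain \<sigma> \<tau> where \<sigma>: "bij_betw \<sigma> {..<?n} (UNIV :: 'n set)" and \<tau>: "bij_betw \<tau> {..<?n} (UNIV :: 'm set)"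
    and inc: "\<And>i k. i < ?n \<Longrightarrow> k < ?n \<Longrightarrow> v (\<sigma> i) \<in> F (\<tau> k) \<longleftrightarrow> i = k \<or> i = Suc k mod ?n"
    using polygon_labelling[OF refl n P v F] by blast
  have cardm: "CARD('m) = ?n" using bij_betw_same_card[OF \<tau>] by simp
  have pP: "polytope P" and dP: "aff_dim P = 2" using P by (auto simp: polygon_with_def)
  have pQ: "polytope ?Q" by (simp add: polytope_convex_hull)
  have cQ: "convex ?Q" by simp
  have VQ: "vertices ?Q = range w" using norm by (rule convex_hull_unit_vectors_vertices)
  have same: "v i \<in> F j \<longleftrightarrow> w i \<bullet> u j = -1" for i j using zero pos by force
  have "inj w"
  proof (rule injI)
    fix a b assume "w a = w b"
    then have ab: "v a \<in> F j \<longleftrightarrow> v b \<in> F j" for j using same by simp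
    obtain i k where ik: "i < ?n" "k < ?n" "a = \<sigma> i" "b = \<sigma> k"
      using \<sigma> unfolding bij_betw_def by (metis UNIV_I imageE lessThan_iff)
    have "i = l \<or> i = Suc l mod ?n \<longleftrightarrow> k = l \<or> k = Suc l mod ?n" if "l < ?n" for l
      using ab[of "\<tau> l"] inc[OF ik(1) that] inc[OF ik(2) that] ik by simp
    \<comment> \<open>A vertex is determined by its edges: if \<open>i\<close> and \<open>k\<close>
      were different, each would be the successor of the other, which is impossible in a cycle of
      length at least 3.\<close>
    from this[of i] this[of k] have "i = k" using ik n by (auto simp: mod_Suc split: if_splits)
    then show "a = b" using ik by simp
  qed
  then have bw: "bij_betw w UNIV (vertices ?Q)" unfolding VQ by (simp add: bij_betw_def)
  have cardV: "card (vertices ?Q) = ?n" using bij_betw_same_card[OF bw] by simp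
  have "aff_dim ?Q = 2"
  proof -
    have "\<not> aff_dim ?Q \<le> 1"
    proof
      assume "aff_dim ?Q \<le> 1"
      then have "collinear ?Q" by (simp add: collinear_aff_dim)
      obtain a b c :: 'n where abc: "a \<noteq> b" "b \<noteq> c" "a \<noteq> c"
      proof -
        obtain T :: "'n set" where "card T = 3" using n obtain_subset_with_card_n by metis
        then show ?thesis using that by (auto simp: card_3_iff)
      qed
      have "\<not> collinear {w a, w b, w c}"
        using \<open>inj w\<close> abc VQ by (intro vertices_not_collinear[OF cQ]) (auto simp: inj_def)
      moreover have "{w a, w b, w c} \<subseteq> ?Q" by (simp add: hull_inc)
      ultimately show False using \<open>collinear ?Q\<close> collinear_subset by blast
    qed
    moreover have "aff_dim ?Q \<le> 2" using aff_dim_le_DIM[of ?Q] by simp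
    ultimately show ?thesis by linarith
  qed
  then have Q: "polygon_with ?n ?Q" using pQ cardV by (simp add: polygon_with_def)
  define G where "G j = ?Q \<inter> {y. u j \<bullet> y = -1}" for j
  have wG: "w -` G j = v -` F j" for j
    using same by (auto simp: G_def hull_inc inner_commute)
  have Ginj: "inj G"
  proof (rule injI)
    fix a b assume "G a = G b"
    then have vF: "v -` F a = v -` F b" using wG by metis
    have "F j face_of P" for j
      using bij_betw_apply[OF F] by (auto simp: facets_def facet_of_imp_face_of)
    moreover have "vertices P \<inter> F a = vertices P \<inter> F b"
    proof -
      have "vertices P = range v" using v by (simp add: bij_betw_def)
      then show ?thesis using vF by (auto simp: set_eq_iff)
    qed
    ultimately have "F a = F b" using face_eq_hull_vertices[OF pP] by metis
    then show "a = b" using F by (auto simp: bij_betw_def inj_def)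
  qed
  have Gfac: "G j facet_of ?Q" for j
  proof -
    have "range w \<subseteq> {y. -1 \<le> u j \<bullet> y}"
    proof -
      have "-1 \<le> u j \<bullet> w i" for i
        using zero[of i j] pos[of i j] by (cases "v i \<in> F j") (simp_all add: inner_commute)
      then show ?thesis by auto
    qed
    then have "?Q \<subseteq> {y. -1 \<le> u j \<bullet> y}"
      using convex_halfspace_ge[of "-1" "u j"] by (intro hull_minimal) auto
    then have face: "G j face_of ?Q"
      unfolding G_def by (intro face_of_Int_supporting_hyperplane_ge) auto
    obtain k where k: "k < ?n" "j = \<tau> k" using \<tau> unfolding bij_betw_def by (metis UNIV_I imageE lessThan_iff)
    have sk: "Suc k mod ?n < ?n" "k \<noteq> Suc k mod ?n" using k n by (auto simp: mod_Suc)
    have vF: "v -` F j = {\<sigma> k, \<sigma> (Suc k mod ?n)}"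
    proof -
      have "v a \<in> F j \<longleftrightarrow> a = \<sigma> k \<or> a = \<sigma> (Suc k mod ?n)" for a
      proof -
        obtain i where "i < ?n" "a = \<sigma> i" using \<sigma> unfolding bij_betw_def by (metis UNIV_I imageE lessThan_iff)
        then show ?thesis using inc k sk \<sigma> by (auto simp: bij_betw_def inj_on_def)
      qed
      then show ?thesis by auto
    qed
    have "vertices ?Q \<inter> G j = w ` (w -` G j)" using VQ by auto
    also have "\<dots> = {w (\<sigma> k), w (\<sigma> (Suc k mod ?n))}" unfolding wG vF by simp
    finally have "G j = convex hull {w (\<sigma> k), w (\<sigma> (Suc k mod ?n))}"
      using face_eq_hull_vertices[OF pQ face] by simp
    moreover have "w (\<sigma> k) \<noteq> w (\<sigma> (Suc k mod ?n))"
      using \<open>inj w\<close> \<sigma> sk k by (auto simp: inj_def bij_betw_def inj_on_def)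
    ultimately have "aff_dim (G j) = 1" by (simp add: aff_dim_convex_hull)
    then show ?thesis using face \<open>aff_dim ?Q = 2\<close> by (auto simp: facet_of_def)
  qed
  obtain x where "bij_betw x {..<?n} (vertices ?Q)" and
    fac: "\<And>F. F facet_of ?Q \<longleftrightarrow> (\<exists>i<?n. F = convex hull {x i, x (Suc i mod ?n)})"
    using polygon_facets[OF Q n] by blast
  have facQ: "facets ?Q = (\<lambda>i. convex hull {x i, x (Suc i mod ?n)}) ` {..<?n}"
    using fac by (auto simp: facets_def)
  have "range G = facets ?Q"
  proof (rule card_seteq)
    show "finite (facets ?Q)" "range G \<subseteq> facets ?Q"
      using facQ Gfac by (auto simp: facets_def)
    have "card (facets ?Q) \<le> ?n" unfolding facQ using card_image_le[of "{..<?n}"] by auto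
    then show "card (facets ?Q) \<le> card (range G)" using Ginj cardm by (simp add: card_image)
  qed
  moreover have "facets P = range F" using F by (simp add: bij_betw_def)
  ultimately have "(\<lambda>F. v -` F) ` facets P = (\<lambda>G. w -` G) ` facets ?Q"
    using wG by (metis (mono_tags, lifting) image_image image_cong)
  then show ?thesis
    using face_vertex_sets_2dim[OF pP v dP] face_vertex_sets_2dim[OF pQ bw \<open>aff_dim ?Q = 2\<close>]
    by (intro combinatorially_equivalentI[OF pP v pQ bw]) simp
qed

section \<open>The semidefinite program\<close>

text \<open>The incidence equations enter only in \<open>sq\<close>: they turn the cross term of the
  completed square into a constant plus a multiple of \<open>M \<bullet> u k\<close>, and the latter
  sums to the linear term of the objective.\<close>

lemma
  fixes w u :: "nat \<Rightarrow> 'a::real_inner"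
  assumes n: "3 \<le> n" and unit: "\<And>j. j < n \<Longrightarrow> norm (w j) = 1"
    and inc: "\<And>k. k < n \<Longrightarrow> w k \<bullet> u k = -1" "\<And>k. k < n \<Longrightarrow> w (Suc k mod n) \<bullet> u k = -1"
  defines "c \<equiv> cos (pi / n)"
  shows polar_energy_bound:
      "n / c\<^sup>2 \<le> (\<Sum>k<n. (norm (u k))\<^sup>2) - 2 / (n * c\<^sup>2) * ((\<Sum>j<n. w j) \<bullet> (\<Sum>k<n. u k))"
    and polar_energy_eq:
      "(\<Sum>k<n. (norm (u k))\<^sup>2) - 2 / (n * c\<^sup>2) * ((\<Sum>j<n. w j) \<bullet> (\<Sum>k<n. u k)) = n / c\<^sup>2 \<Longrightarrow>
       \<exists>p q. (\<forall>j<n. w j = cos (2 * pi * real j / n) *\<^sub>R p + sin (2 * pi * real j / n) *\<^sub>R q) \<and>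
         (\<forall>k<n. u k = - (1 / (2 * c\<^sup>2)) *\<^sub>R (w k + w (Suc k mod n)))"
proof -
  have "pi / n < pi / 2" using n by (intro divide_strict_left_mono) auto
  then have c: "0 < c" unfolding c_def using n by (intro cos_gt_zero_pi) (auto intro: less_trans[of _ 0])
  \<comment> \<open>In the regular polygon \<open>w k + w (Suc k mod n)\<close> has length
    \<open>2 * c\<close>, and the pole of that edge points the opposite way with length
    \<open>1 / c\<close>; this is the ratio of the lengths.\<close>
  define \<mu> where "\<mu> = 1 / (2 * c\<^sup>2)"
  have \<mu>: "0 < \<mu>" "\<mu>\<^sup>2 * (4 * c\<^sup>2) = 1 / c\<^sup>2" "4 * \<mu> = 2 / c\<^sup>2"
    using c by (simp_all add: \<mu>_def power2_eq_square)
  define M where "M = (1 / n) *\<^sub>R (\<Sum>j<n. w j)"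
  define y where "y j = w j - M" for j
  let ?W = "\<Sum>j<n. w j" and ?U = "\<Sum>k<n. u k"
  let ?L = "(\<Sum>k<n. (norm (u k))\<^sup>2) - 2 / (n * c\<^sup>2) * (?W \<bullet> ?U)"
  have W: "?W = real n *\<^sub>R M" using n by (simp add: M_def)
  have y0: "(\<Sum>j<n. y j) = 0" by (simp add: y_def sum_subtractf W sum_constant_scaleR)
  have sq: "(norm (u k + \<mu> *\<^sub>R (y k + y (Suc k mod n))))\<^sup>2 =
      (norm (u k))\<^sup>2 - 4 * \<mu> - 4 * \<mu> * (M \<bullet> u k) + \<mu>\<^sup>2 * (norm (y k + y (Suc k mod n)))\<^sup>2" if "k < n" for k
  proof -
    have "(norm (u k + \<mu> *\<^sub>R (y k + y (Suc k mod n))))\<^sup>2 =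
      (norm (u k))\<^sup>2 + 2 * \<mu> * ((y k + y (Suc k mod n)) \<bullet> u k) + \<mu>\<^sup>2 * (norm (y k + y (Suc k mod n)))\<^sup>2"
    proof -
      have "(norm (a + t *\<^sub>R b))\<^sup>2 = (norm a)\<^sup>2 + 2 * t * (b \<bullet> a) + t\<^sup>2 * (norm b)\<^sup>2" for a b :: 'a and t
        unfolding power2_norm_eq_inner
        by (simp add: inner_add_left inner_add_right inner_commute power2_eq_square algebra_simps)
      then show ?thesis .
    qed
    also have "(y k + y (Suc k mod n)) \<bullet> u k = - 2 - 2 * (M \<bullet> u k)"
      using inc[OF that] by (simp add: y_def inner_add_left inner_diff_left)
    finally show ?thesis by (simp add: algebra_simps)
  qed
  \<comment> \<open>Centering costs \<open>n * (norm M)\<^sup>2\<close>, which returns in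
    \<open>id\<close> as the penalty for a nonzero mean.\<close>
  have ysum: "(\<Sum>j<n. (norm (y j))\<^sup>2) = n - n * (norm M)\<^sup>2"
  proof -
    have "(\<Sum>j<n. (norm (y j))\<^sup>2) = (\<Sum>j<n. (norm (w j))\<^sup>2) - 2 * (?W \<bullet> M) + n * (norm M)\<^sup>2"
      by (simp add: y_def power2_norm_eq_inner inner_diff_left inner_diff_right inner_commute
          sum.distrib sum_subtractf inner_sum_left inner_sum_right sum_distrib_left)
    also have "(\<Sum>j<n. (norm (w j))\<^sup>2) = n" by (simp add: unit)
    finally show ?thesis by (simp add: W power2_norm_eq_inner)
  qed
  let ?D = "4 * c\<^sup>2 * (\<Sum>j<n. (norm (y j))\<^sup>2) - (\<Sum>k<n. (norm (y k + y (Suc k mod n)))\<^sup>2)"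
  have D: "0 \<le> ?D" using discrete_wirtinger[OF n y0] by (simp add: c_def)
  have id: "?L - n / c\<^sup>2 = (\<Sum>k<n. (norm (u k + \<mu> *\<^sub>R (y k + y (Suc k mod n))))\<^sup>2) +
      n / c\<^sup>2 * (norm M)\<^sup>2 + \<mu>\<^sup>2 * ?D"
  proof -
    have "(\<Sum>k<n. (norm (u k + \<mu> *\<^sub>R (y k + y (Suc k mod n))))\<^sup>2) =
        (\<Sum>k<n. (norm (u k))\<^sup>2) - 4 * \<mu> * n - 4 * \<mu> * (M \<bullet> ?U) +
        \<mu>\<^sup>2 * (\<Sum>k<n. (norm (y k + y (Suc k mod n)))\<^sup>2)"
      by (simp add: sq sum.distrib sum_subtractf sum_distrib_left inner_sum_right)
    moreover have "\<mu>\<^sup>2 * ?D = 1 / c\<^sup>2 * (n - n * (norm M)\<^sup>2) - \<mu>\<^sup>2 * (\<Sum>k<n. (norm (y k + y (Suc k mod n)))\<^sup>2)"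
      by (simp only: ysum right_diff_distrib mult.assoc[symmetric] \<mu>(2)[unfolded mult.assoc[symmetric]])
    moreover have "2 / (n * c\<^sup>2) * (?W \<bullet> ?U) = 2 / c\<^sup>2 * (M \<bullet> ?U)"
      using n unfolding W by simp
    moreover have "2 / c\<^sup>2 * n = n / c\<^sup>2 + n / c\<^sup>2" "1 / c\<^sup>2 * (n - n * (norm M)\<^sup>2) = n / c\<^sup>2 - n / c\<^sup>2 * (norm M)\<^sup>2"
      by (simp_all add: algebra_simps diff_divide_distrib)
    ultimately show ?thesis unfolding \<mu>(3) by linarith
  qed
  have nonneg: "0 \<le> (\<Sum>k<n. (norm (u k + \<mu> *\<^sub>R (y k + y (Suc k mod n))))\<^sup>2)" "0 \<le> n / c\<^sup>2 * (norm M)\<^sup>2"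
    "0 \<le> \<mu>\<^sup>2 * ?D"
    using D by (auto intro: sum_nonneg mult_nonneg_nonneg simp del: right_diff_distrib)
  show "n / c\<^sup>2 \<le> ?L" using id nonneg by linarith
  assume "?L = n / c\<^sup>2"
  then have z: "(\<Sum>k<n. (norm (u k + \<mu> *\<^sub>R (y k + y (Suc k mod n))))\<^sup>2) = 0" "n / c\<^sup>2 * (norm M)\<^sup>2 = 0"
    "\<mu>\<^sup>2 * ?D = 0"
    using id nonneg by linarith+
  \<comment> \<open>With zero mean the centered sequence is the original one, so the equality case
    of the Wirtinger inequality describes \<open>w\<close> itself.\<close>
  have M0: "M = 0" using z(2) n c by simp
  then have yw: "y = w" by (simp add: y_def fun_eq_iff)
  have "?D = 0" using z(3) \<mu>(1) by simp
  then obtain p q where pq: "\<forall>j<n. w j = cos (2 * pi * real j / n) *\<^sub>R p + sin (2 * pi * real j / n) *\<^sub>R q"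
    using discrete_wirtinger_eq[OF n y0] unfolding yw c_def by auto
  have "\<forall>k\<in>{..<n}. (norm (u k + \<mu> *\<^sub>R (w k + w (Suc k mod n))))\<^sup>2 = 0"
    using z(1) unfolding yw by (subst (asm) sum_nonneg_eq_0_iff) auto
  then have "\<forall>k<n. u k = - (1 / (2 * c\<^sup>2)) *\<^sub>R (w k + w (Suc k mod n))"
    by (simp add: \<mu>_def eq_neg_iff_add_eq_0)
  then show "\<exists>p q. (\<forall>j<n. w j = cos (2 * pi * real j / n) *\<^sub>R p + sin (2 * pi * real j / n) *\<^sub>R q) \<and>
         (\<forall>k<n. u k = - (1 / (2 * c\<^sup>2)) *\<^sub>R (w k + w (Suc k mod n)))"
    using pq by blast
qed

section \<open>The block matrix as a Gram matrix\<close>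

lemma sum_UNIV_Plus:
  "sum f (UNIV :: ('a::finite + 'b::finite) set) = (\<Sum>a\<in>UNIV. f (Inl a)) + (\<Sum>b\<in>UNIV. f (Inr b))"
  by (simp add: UNIV_Plus_UNIV[symmetric] sum.Plus del: UNIV_Plus_UNIV)

lemma trace_block_matrix:
  "trace (block_matrix A S B) = 1 + (\<Sum>i\<in>UNIV. A $ i $ i) + (\<Sum>j\<in>UNIV. B $ j $ j)"
  by (simp add: trace_def sum_UNIV_Plus block_matrix_def)

text \<open>The first component of a pair is the direction of the unit vector belonging to the first
  row; every vector has coordinate 1 there, which accounts for the summand 1 in each entry.\<close>

lemma block_matrix_gram:
  fixes w :: "'n::finite \<Rightarrow> 'a::real_inner" and u :: "'m::finite \<Rightarrow> 'a"
  assumes "\<And>i k. A $ i $ k = 1 + w i \<bullet> w k" "\<And>i j. S $ i $ j = 1 + w i \<bullet> u j"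
    "\<And>j l. B $ j $ l = 1 + u j \<bullet> u l"
  defines "g \<equiv> case_sum (\<lambda>_::unit. (1::real, 0)) (case_sum (\<lambda>i. (1, w i)) (\<lambda>j. (1, u j)))"
  shows "block_matrix A S B $ r $ c = g r \<bullet> g c"
  by (cases "(A, S, B, r, c)" rule: block_entry.cases)
    (simp_all add: block_matrix_def g_def assms inner_commute split: sum.splits)

text \<open>The vector of the first row has length 1 and inner product 1 with all others.
  Subtracting it lowers every entry of \<open>A\<close>, \<open>S\<close> and \<open>B\<close> by 1,
  so the diagonal condition becomes unit length.\<close>

lemma feasible_imp_gram:
  fixes A :: "real^'n::finite^'n" and S :: "real^'m::finite^'n" and B :: "real^'m^'m"
  assumes "sdp_feasible I A S B"
  obtains w :: "'n \<Rightarrow> real^(unit + 'n + 'm)" and u :: "'m \<Rightarrow> real^(unit + 'n + 'm)"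
  where "\<And>i. norm (w i) = 1" "\<And>i k. A $ i $ k = 1 + w i \<bullet> w k" "\<And>i j. S $ i $ j = 1 + w i \<bullet> u j"
    "\<And>j l. B $ j $ l = 1 + u j \<bullet> u l"
proof -
  have psd: "psd (block_matrix A S B)" and A2: "A $ i $ i = 2" for i
    using assms by (auto simp: sdp_feasible_def)
  obtain f :: "unit + 'n + 'm \<Rightarrow> real^(unit + 'n + 'm)"
    where "\<And>r c. block_matrix A S B $ r $ c = f r \<bullet> f c"
    using psd_imp_gram[OF psd] by blast
  then have f: "f r \<bullet> f c = block_entry A S B r c" for r c
    by (simp add: block_matrix_def)
  define w where "w i = f (Inr (Inl i)) - f (Inl ())" for i
  define u where "u j = f (Inr (Inr j)) - f (Inl ())" for j
  have A: "A $ i $ k = 1 + w i \<bullet> w k" and S: "S $ i $ j = 1 + w i \<bullet> u j" and B: "B $ j $ l = 1 + u j \<bullet> u l"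
    for i k j l
    by (simp_all add: w_def u_def inner_diff_left inner_diff_right f)
  have "norm (w i) = 1" for i using A2[of i] A[of i i] by (simp add: norm_eq_1)
  then show ?thesis using that A S B by blast
qed

text \<open>The cyclic labelling \<open>\<sigma>\<close>, \<open>\<tau>\<close> lists the vertices and edges of the polygon in order, edge
  \<open>k\<close> joining the vertices \<open>k\<close> and \<open>k + 1\<close>.\<close>

locale cyclic_sdp =
  fixes I :: "('n::finite \<times> 'm::finite) set" and lam :: "'n \<Rightarrow> 'm \<Rightarrow> real"
    and n :: nat and \<sigma> :: "nat \<Rightarrow> 'n" and \<tau> :: "nat \<Rightarrow> 'm"
  assumes n3: "3 \<le> n"
    and \<sigma>: "bij_betw \<sigma> {..<n} UNIV" and \<tau>: "bij_betw \<tau> {..<n} UNIV"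
    and inc: "\<And>i k. i < n \<Longrightarrow> k < n \<Longrightarrow> (\<sigma> i, \<tau> k) \<in> I \<longleftrightarrow> i = k \<or> i = Suc k mod n"
    and lam: "\<And>i j. (i, j) \<notin> I \<Longrightarrow> lam i j = 2 / real n * (1 / cos (pi / real n))\<^sup>2"
begin

definition c :: real where "c = cos (pi / n)"

lemma c_pos: "0 < c"
proof -
  have "pi / n < pi / 2" using n3 by (intro divide_strict_left_mono) auto
  then show ?thesis unfolding c_def using n3 by (intro cos_gt_zero_pi) (auto intro: less_trans[of _ 0])
qed

lemma sum_\<sigma>: "(\<Sum>i\<in>UNIV. f i) = (\<Sum>i<n. f (\<sigma> i))"
  using sum.reindex_bij_betw[OF \<sigma>] by metis

lemma sum_\<tau>: "(\<Sum>j\<in>UNIV. f j) = (\<Sum>k<n. f (\<tau> k))"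
  using sum.reindex_bij_betw[OF \<tau>] by metis

text \<open>\<open>S\<close> vanishes on \<open>I\<close>, so the weighted sum may run over all
  pairs with one constant weight, whatever \<open>lam\<close> is on \<open>I\<close>.\<close>

lemma objective_eq:
  assumes "sdp_feasible I A S B"
  shows "sdp_objective I lam A S B = 1 + 2 * n + (\<Sum>k<n. B $ \<tau> k $ \<tau> k) -
     2 / (n * c\<^sup>2) * (\<Sum>i<n. \<Sum>k<n. S $ \<sigma> i $ \<tau> k)"
proof -
  have S0: "S $ i $ j = 0" if "(i, j) \<in> I" for i j
    using assms that by (auto simp: sdp_feasible_def)
  have A2: "A $ i $ i = 2" for i using assms by (auto simp: sdp_feasible_def)
  have "(\<Sum>(i, j)\<in>- I. lam i j * S $ i $ j) = (\<Sum>(i, j)\<in>- I. 2 / (n * c\<^sup>2) * S $ i $ j)"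
    by (intro sum.cong refl) (auto simp: lam c_def power_divide)
  also have "\<dots> = (\<Sum>(i, j)\<in>UNIV. 2 / (n * c\<^sup>2) * S $ i $ j)"
    by (intro sum.mono_neutral_left) (auto simp: S0)
  also have "\<dots> = 2 / (n * c\<^sup>2) * (\<Sum>i\<in>UNIV. \<Sum>j\<in>UNIV. S $ i $ j)"
    by (simp add: UNIV_Times_UNIV[symmetric] sum.cartesian_product[symmetric] sum_distrib_left
        del: UNIV_Times_UNIV)
  finally show ?thesis
    using bij_betw_same_card[OF \<sigma>]
    by (simp add: sdp_objective_def trace_block_matrix A2 sum_\<sigma> sum_\<tau>)
qed

lemma objective_gram:
  fixes w :: "'n \<Rightarrow> 'a::real_inner" and u :: "'m \<Rightarrow> 'a"
  assumes feas: "sdp_feasible I A S B"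
    and "\<And>i j. S $ i $ j = 1 + w i \<bullet> u j" "\<And>j l. B $ j $ l = 1 + u j \<bullet> u l"
  shows "sdp_objective I lam A S B = 1 + 3 * n - 2 * n / c\<^sup>2 + ((\<Sum>k<n. (norm (u (\<tau> k)))\<^sup>2) -
     2 / (n * c\<^sup>2) * ((\<Sum>i<n. w (\<sigma> i)) \<bullet> (\<Sum>k<n. u (\<tau> k))))"
proof -
  have "(\<Sum>k<n. B $ \<tau> k $ \<tau> k) = n + (\<Sum>k<n. (norm (u (\<tau> k)))\<^sup>2)"
    by (simp add: assms sum.distrib power2_norm_eq_inner)
  moreover have "(\<Sum>i<n. \<Sum>k<n. S $ \<sigma> i $ \<tau> k) = n * n + (\<Sum>i<n. w (\<sigma> i)) \<bullet> (\<Sum>k<n. u (\<tau> k))"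
    unfolding inner_sum_left unfolding inner_sum_right by (simp add: assms sum.distrib)
  moreover have "2 / (n * c\<^sup>2) * (n * n) = 2 * n / c\<^sup>2" using n3 by simp
  ultimately show ?thesis by (simp add: objective_eq[OF feas] ring_distribs)
qed

lemma feasible_incident:
  assumes "sdp_feasible I A S B" "\<And>i j. S $ i $ j = 1 + w i \<bullet> u j" "k < n"
  shows "w (\<sigma> k) \<bullet> u (\<tau> k) = -1" "w (\<sigma> (Suc k mod n)) \<bullet> u (\<tau> k) = -1"
proof -
  have "(\<sigma> k, \<tau> k) \<in> I" "(\<sigma> (Suc k mod n), \<tau> k) \<in> I" using inc assms(3) by auto
  then have "S $ \<sigma> k $ \<tau> k = 0" "S $ \<sigma> (Suc k mod n) $ \<tau> k = 0"
    using assms(1) by (auto simp: sdp_feasible_def)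
  then show "w (\<sigma> k) \<bullet> u (\<tau> k) = -1" "w (\<sigma> (Suc k mod n)) \<bullet> u (\<tau> k) = -1"
    by (simp_all add: assms(2))
qed

lemma objective_lower_bound:
  assumes feas: "sdp_feasible I A S B"
  shows "1 + 3 * n - n / c\<^sup>2 \<le> sdp_objective I lam A S B"
proof -
  obtain w :: "'n \<Rightarrow> real^(unit + 'n + 'm)" and u :: "'m \<Rightarrow> real^(unit + 'n + 'm)"
    where unit: "\<And>i. norm (w i) = 1" and "\<And>i k. A $ i $ k = 1 + w i \<bullet> w k"
      and S: "\<And>i j. S $ i $ j = 1 + w i \<bullet> u j" and B: "\<And>j l. B $ j $ l = 1 + u j \<bullet> u l"
    using feasible_imp_gram[OF feas] by blast
  show ?thesis
    using polar_energy_bound[OF n3, of "\<lambda>i. w (\<sigma> i)" "\<lambda>k. u (\<tau> k)"] unit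
      feasible_incident[OF feas S] objective_gram[OF feas S B]
    by (simp add: c_def)
qed

lemma cos_sin_combination_inner:
  fixes p q :: "'a::real_inner"
  shows "(a *\<^sub>R p + b *\<^sub>R q) \<bullet> (a' *\<^sub>R p + b' *\<^sub>R q) =
     a * a' * (p \<bullet> p) + (a * b' + b * a') * (p \<bullet> q) + b * b' * (q \<bullet> q)"
  by (simp add: inner_add_left inner_add_right inner_commute algebra_simps)

text \<open>At the optimal value every \<open>w\<close> is a combination of two vectors
  \<open>p\<close>, \<open>q\<close>, and every \<open>u\<close> is a multiple of a sum of two
  \<open>w\<close>. Since only inner products matter, \<open>p\<close> and \<open>q\<close> may be
  replaced by plane vectors with the same Gram matrix.\<close>

lemma attained_imp_planar:
  assumes feas: "sdp_feasible I A S B"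
    and eq: "sdp_objective I lam A S B = 1 + 3 * n - n / c\<^sup>2"
  obtains w :: "'n \<Rightarrow> real^2" and u :: "'m \<Rightarrow> real^2"
  where "\<And>i. norm (w i) = 1" "\<And>i k. A $ i $ k = 1 + w i \<bullet> w k" "\<And>i j. S $ i $ j = 1 + w i \<bullet> u j"
proof -
  obtain w :: "'n \<Rightarrow> real^(unit + 'n + 'm)" and u :: "'m \<Rightarrow> real^(unit + 'n + 'm)"
    where unit: "\<And>i. norm (w i) = 1" and A: "\<And>i k. A $ i $ k = 1 + w i \<bullet> w k"
      and S: "\<And>i j. S $ i $ j = 1 + w i \<bullet> u j" and B: "\<And>j l. B $ j $ l = 1 + u j \<bullet> u l"
    using feasible_imp_gram[OF feas] by blast
  have "(\<Sum>k<n. (norm (u (\<tau> k)))\<^sup>2) - 2 / (n * c\<^sup>2) * ((\<Sum>i<n. w (\<sigma> i)) \<bullet> (\<Sum>k<n. u (\<tau> k))) = n / c\<^sup>2"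
    using objective_gram[OF feas S B] eq by simp
  then obtain p q where
      w: "\<And>j. j < n \<Longrightarrow> w (\<sigma> j) = cos (2 * pi * real j / n) *\<^sub>R p + sin (2 * pi * real j / n) *\<^sub>R q"
      and u: "\<And>k. k < n \<Longrightarrow> u (\<tau> k) = - (1 / (2 * c\<^sup>2)) *\<^sub>R (w (\<sigma> k) + w (\<sigma> (Suc k mod n)))"
    using polar_energy_eq[OF n3, of "\<lambda>i. w (\<sigma> i)" "\<lambda>k. u (\<tau> k)"] unit
      feasible_incident[OF feas S] unfolding c_def by blast
  \<comment> \<open>\<open>p\<close> and \<open>q\<close> need not be orthonormal or even
    independent, so the plane vectors come from factoring their 2 by 2 Gram matrix.\<close>
  define g :: "2 \<Rightarrow> _" where "g i = (if i = 1 then p else q)" for i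
  have "psd (\<chi> i j. g i \<bullet> g j)" by (rule gram_imp_psd[of _ g]) simp
  then obtain f :: "2 \<Rightarrow> real^2" where f: "\<And>i j. (\<chi> i j. g i \<bullet> g j) $ i $ j = f i \<bullet> f j"
    using psd_imp_gram by blast
  have pq: "p \<bullet> p = f 1 \<bullet> f 1" "p \<bullet> q = f 1 \<bullet> f 2" "q \<bullet> q = f 2 \<bullet> f 2"
    using f[of 1 1] f[of 1 2] f[of 2 2] by (simp_all add: g_def)
  define \<iota> where "\<iota> = inv_into {..<n} \<sigma>"
  define \<kappa> where "\<kappa> = inv_into {..<n} \<tau>"
  have \<iota>: "\<iota> i < n" "\<sigma> (\<iota> i) = i" for i
    using \<sigma> inv_into_into[of i \<sigma> "{..<n}"] by (auto simp: \<iota>_def bij_betw_def f_inv_into_f)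
  have \<kappa>: "\<kappa> j < n" "\<tau> (\<kappa> j) = j" for j
    using \<tau> inv_into_into[of j \<tau> "{..<n}"] by (auto simp: \<kappa>_def bij_betw_def f_inv_into_f)
  define W where "W j = cos (2 * pi * real j / n) *\<^sub>R f 1 + sin (2 * pi * real j / n) *\<^sub>R f 2" for j
  define w' where "w' i = W (\<iota> i)" for i
  define u' where "u' j = - (1 / (2 * c\<^sup>2)) *\<^sub>R (W (\<kappa> j) + W (Suc (\<kappa> j) mod n))" for j
  have WW: "W i \<bullet> W j = w (\<sigma> i) \<bullet> w (\<sigma> j)" if "i < n" "j < n" for i j
    unfolding W_def w[OF that(1)] w[OF that(2)] cos_sin_combination_inner pq ..
  have ww: "w' i \<bullet> w' k = w i \<bullet> w k" for i k
    using WW[OF \<iota>(1) \<iota>(1), of i k] by (simp add: w'_def \<iota>)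
  have wu: "w' i \<bullet> u' j = w i \<bullet> u j" for i j
  proof -
    have "Suc (\<kappa> j) mod n < n" using n3 by simp
    then show ?thesis
      using u[OF \<kappa>(1), of j] WW[OF \<iota>(1) \<kappa>(1), of i j] WW[OF \<iota>(1), of "Suc (\<kappa> j) mod n" i]
      by (simp add: w'_def u'_def \<iota> \<kappa> inner_add_right)
  qed
  show ?thesis
    by (rule that[of w' u']) (use unit A S ww wu in \<open>simp_all add: norm_eq_1\<close>)
qed

section \<open>The regular polygon, its poles and the optimal solution\<close>

definition circ :: "nat \<Rightarrow> real^2" where
  "circ j = vector [cos (2 * pi * real j / n), sin (2 * pi * real j / n)]"

text \<open>The equality case of the energy bound; the sign makes the inner product with both ends
  of the edge -1. \<open>circ\<close> is periodic, so the index \<open>Suc k\<close> is not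
  reduced.\<close>

definition pole :: "nat \<Rightarrow> real^2" where
  "pole k = - (1 / (2 * c\<^sup>2)) *\<^sub>R (circ k + circ (Suc k))"

lemma circ_inner: "circ i \<bullet> circ j = cos (2 * pi * (real i - real j) / n)"
proof -
  have "2 * pi * (real i - real j) / n = 2 * pi * real i / n - 2 * pi * real j / n"
    by (simp add: algebra_simps diff_divide_distrib)
  then show ?thesis by (simp add: circ_def inner_vec_def sum_2 cos_diff)
qed

lemma circ_mod: "k < n \<Longrightarrow> circ (Suc k mod n) = circ (Suc k)"
  by (cases "Suc k = n") (auto simp: circ_def mod_Suc)

lemma sum_circ: "(\<Sum>j<n. circ j) = 0"
  using sum_cos_multiples[of n 1] sum_sin_multiples[of n 1] n3
  by (simp add: vec_eq_iff forall_2 circ_def)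

text \<open>The angle on the right is measured from the midpoint of edge \<open>k\<close>, at index
  \<open>k + 1/2\<close>; the formula is the sum of two cosines turned into a product.\<close>

lemma circ_pole: "circ i \<bullet> pole k = - cos (pi * (2 * (real i - real k) - 1) / n) / c"
proof -
  define t where "t = pi * (2 * (real i - real k) - 1) / n"
  have "2 * pi * (real i - real k) / n = t + pi / n" "2 * pi * (real i - real (Suc k)) / n = t - pi / n"
    unfolding t_def add_divide_distrib[symmetric] diff_divide_distrib[symmetric]
    by (rule arg_cong[of _ _ "\<lambda>x. x / n"], simp add: algebra_simps)+
  then have "circ i \<bullet> pole k = - (1 / (2 * c\<^sup>2)) * (cos (t + pi / n) + cos (t - pi / n))"
    unfolding pole_def inner_scaleR_right inner_add_right circ_inner by simp
  also have "\<dots> = - cos t / c"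
    using c_pos by (simp add: cos_add cos_diff c_def[symmetric] power2_eq_square)
  finally show ?thesis by (simp add: t_def)
qed

lemma pole_norm: "(norm (pole k))\<^sup>2 = 1 / c\<^sup>2"
proof -
  have "circ j \<bullet> pole k = -1" if "j = k \<or> j = Suc k" for j
    using that circ_pole[of j k] c_pos by (auto simp: c_def)
  then have "(circ k + circ (Suc k)) \<bullet> pole k = -2" by (simp add: inner_add_left)
  then show ?thesis
    unfolding power2_norm_eq_inner by (subst (1) pole_def) simp
qed

lemma circ_pole_incident:
  assumes "k < n" "i = k \<or> i = Suc k mod n"
  shows "circ i \<bullet> pole k = -1"
proof -
  have "circ i = circ k \<or> circ i = circ (Suc k)" using assms circ_mod by auto
  then show ?thesis using circ_pole[of k k] circ_pole[of "Suc k" k] c_pos by (auto simp: c_def)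
qed

text \<open>Up to sign, the angle of such a vertex from the midpoint of the edge lies strictly
  between \<open>pi / n\<close> and \<open>2 * pi - pi / n\<close>, so its cosine is below
  \<open>c\<close>.\<close>

lemma circ_pole_nonincident:
  assumes "i < n" "k < n" "\<not> (i = k \<or> i = Suc k mod n)"
  shows "-1 < circ i \<bullet> pole k"
proof -
  define l where "l = \<bar>2 * (real i - real k) - 1\<bar>"
  define d where "d = int i - int k"
  \<comment> \<open>The difference \<open>1 - int n\<close> is the wrap-around incidence of vertex 0
    with edge \<open>n - 1\<close>.\<close>
  have "d \<noteq> 0" "d \<noteq> 1" "d \<noteq> 1 - int n" "1 - int n \<le> d" "d < int n"
    using assms by (auto simp: d_def mod_Suc split: if_splits)
  then have "1 < \<bar>2 * d - 1\<bar> \<and> \<bar>2 * d - 1\<bar> < 2 * int n - 1" by presburger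
  then have "1 < \<bar>2 * (int i - int k) - 1\<bar>" "\<bar>2 * (int i - int k) - 1\<bar> < 2 * int n - 1"
    by (auto simp: d_def)
  then have "real_of_int 1 < \<bar>2 * (int i - int k) - 1\<bar>" "real_of_int \<bar>2 * (int i - int k) - 1\<bar> < real_of_int (2 * int n - 1)"
    by (simp_all only: of_int_less_iff)
  then have l: "1 < l" "l < 2 * n - 1" by (simp_all add: l_def)
  have "cos (pi * l / n) < cos (pi / n)"
  proof (rule cos_less_cos)
    have "pi * l < pi * (2 * n - 1)" using l by simp
    then have "pi * l / n < pi * (2 * n - 1) / n" using n3 by (intro divide_strict_right_mono) auto
    also have "\<dots> = 2 * pi - pi / n" using n3 by (simp add: field_simps)
    finally show "pi * l / n < 2 * pi - pi / n" .
    show "pi / n < pi * l / n" using l n3 by (intro divide_strict_right_mono) auto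
  qed simp
  moreover have "cos (pi * l / n) = cos (pi * (2 * (real i - real k) - 1) / n)"
  proof -
    have "pi * l / n = \<bar>pi * (2 * (real i - real k) - 1) / n\<bar>"
      by (simp add: l_def abs_mult)
    then show ?thesis by (simp only: cos_abs_real)
  qed
  ultimately show ?thesis using c_pos by (simp add: circ_pole c_def)
qed

text \<open>For the regular polygon and its poles the vertices sum to zero, which removes the linear
  term, and the squared pole lengths add up to \<open>n / c\<^sup>2\<close>. The lower bound is thus
  attained, and every optimum has this value.\<close>

lemma strict_solution_exists: "\<exists>A S B. strict_solution I lam A S B"
  and optimal_value: "sdp_optimal I lam A S B \<Longrightarrow> sdp_objective I lam A S B = 1 + 3 * n - n / c\<^sup>2"
proof -
  define \<iota> where "\<iota> = inv_into {..<n} \<sigma>"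
  define \<kappa> where "\<kappa> = inv_into {..<n} \<tau>"
  have \<iota>: "\<iota> i < n" "\<sigma> (\<iota> i) = i" for i
    using \<sigma> inv_into_into[of i \<sigma> "{..<n}"] by (auto simp: \<iota>_def bij_betw_def f_inv_into_f)
  have \<kappa>: "\<kappa> j < n" "\<tau> (\<kappa> j) = j" for j
    using \<tau> inv_into_into[of j \<tau> "{..<n}"] by (auto simp: \<kappa>_def bij_betw_def f_inv_into_f)
  have \<iota>\<sigma>: "\<iota> (\<sigma> k) = k" and \<kappa>\<tau>: "\<kappa> (\<tau> k) = k" if "k < n" for k
    using \<sigma> \<tau> that by (simp_all add: \<iota>_def \<kappa>_def bij_betw_def)
  define w where "w i = circ (\<iota> i)" for i
  define u where "u j = pole (\<kappa> j)" for j
  define A :: "real^'n^'n" where "A = (\<chi> i k. 1 + w i \<bullet> w k)"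
  define S :: "real^'m^'n" where "S = (\<chi> i j. 1 + w i \<bullet> u j)"
  define B :: "real^'m^'m" where "B = (\<chi> j l. 1 + u j \<bullet> u l)"
  have ASB: "A $ i $ k = 1 + w i \<bullet> w k" "S $ i $ j = 1 + w i \<bullet> u j" "B $ j $ l = 1 + u j \<bullet> u l" for i k j l
    by (simp_all add: A_def S_def B_def)
  define g where "g = case_sum (\<lambda>_::unit. (1::real, 0)) (case_sum (\<lambda>i. (1, w i)) (\<lambda>j. (1, u j)))"
  have g: "block_matrix A S B $ r $ s = g r \<bullet> g s" for r s
    unfolding g_def using ASB by (rule block_matrix_gram)
  have I: "(i, j) \<in> I \<longleftrightarrow> \<iota> i = \<kappa> j \<or> \<iota> i = Suc (\<kappa> j) mod n" for i j
    using inc[OF \<iota>(1) \<kappa>(1), of i j] by (simp add: \<iota> \<kappa>)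
  have S0: "S $ i $ j = 0" if "(i, j) \<in> I" for i j
    using circ_pole_incident[OF \<kappa>(1)] that by (simp add: ASB w_def u_def I)
  have Spos: "0 < S $ i $ j" if "(i, j) \<notin> I" for i j
    using circ_pole_nonincident[OF \<iota>(1) \<kappa>(1), of i j] that by (simp add: ASB w_def u_def I)
  have feas: "sdp_feasible I A S B"
    unfolding sdp_feasible_def
    using gram_imp_psd[OF g] S0 by (auto simp: ASB w_def circ_inner)
  have "(\<Sum>k<n. (norm (u (\<tau> k)))\<^sup>2) = n / c\<^sup>2"
    by (simp add: u_def \<kappa>\<tau> pole_norm)
  moreover have "(\<Sum>i<n. w (\<sigma> i)) = 0"
    using sum_circ by (simp add: w_def \<iota>\<sigma>)
  ultimately have obj: "sdp_objective I lam A S B = 1 + 3 * n - n / c\<^sup>2"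
    using objective_gram[OF feas ASB(2,3)] by simp
  have opt: "sdp_optimal I lam A S B"
    unfolding sdp_optimal_def using feas obj objective_lower_bound by simp
  show "sdp_objective I lam A S B = 1 + 3 * n - n / c\<^sup>2" if "sdp_optimal I lam A S B" for A S B
    using that opt obj objective_lower_bound[of A S B] unfolding sdp_optimal_def by (metis order_antisym)
  \<comment> \<open>The vectors live in a space of dimension 3, so the rank is 3 once they span
    it.\<close>
  have "span (range g) = UNIV"
  proof -
    have "(1, 0) \<in> range g" by (rule range_eqI[of _ _ "Inl ()"]) (simp add: g_def)
    then have e: "(1, 0) \<in> span (range g)" by (rule span_base)
    have wg: "(0, circ i) \<in> span (range g)" if "i < n" for i
    proof -
      have "(1, circ i) \<in> range g"
        using that by (intro range_eqI[of _ _ "Inr (Inl (\<sigma> i))"]) (simp add: g_def w_def \<iota>\<sigma>)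
      then have "(1, circ i) - (1, 0) \<in> span (range g)" using e by (intro span_diff span_base[of "(1, circ i)"])
      then show ?thesis by simp
    qed
    \<comment> \<open>\<open>circ 0\<close> and \<open>circ 1\<close> are independent because
      \<open>2 * pi / n\<close> lies strictly between 0 and \<open>pi\<close>.\<close>
    define s where "s = sin (2 * pi / n)"
    have "2 * pi / n < pi" using n3 by (simp add: field_simps)
    then have s: "s \<noteq> 0" using sin_gt_zero[of "2 * pi / n"] n3 by (simp add: s_def)
    have "(x, y) \<in> span (range g)" for x and y :: "real^2"
    proof -
      define b where "b = y $ 2 / s"
      define a where "a = y $ 1 - b * cos (2 * pi / n)"
      have "y = a *\<^sub>R circ 0 + b *\<^sub>R circ 1"
        using s by (simp add: vec_eq_iff forall_2 circ_def a_def b_def s_def[symmetric])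
      then have "(x, y) = x *\<^sub>R (1, 0) + (a *\<^sub>R (0, circ 0) + b *\<^sub>R (0, circ 1))" by simp
      also have "\<dots> \<in> span (range g)"
        using e wg[of 0] wg[of 1] n3 by (intro span_add span_scale) auto
      finally show ?thesis .
    qed
    then show ?thesis by auto
  qed
  from rank_gram[OF g this] have "rank (block_matrix A S B) = 3" by simp
  then show "\<exists>A S B. strict_solution I lam A S B"
    unfolding strict_solution_def using opt Spos by blast
qed

end

text \<open>Optimality puts the Gram vectors in a plane. Feasibility and strict positivity of
  \<open>S\<close> then say that \<open>w i \<bullet> u j\<close> is -1 on incident pairs and larger
  elsewhere, so the \<open>u j\<close> expose the facets of an inscribed copy of
  \<open>P\<close>.\<close>

lemma strict_solution_certifies:
  fixes P :: "(real^2) set" and v :: "'n::finite \<Rightarrow> real^2" and F :: "'m::finite \<Rightarrow> (real^2) set"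
  assumes n: "3 \<le> CARD('n)" and P: "polygon_with CARD('n) P"
    and v: "bij_betw v UNIV (vertices P)" and F: "bij_betw F UNIV (facets P)"
    and "cyclic_sdp (incidences v F) lam CARD('n) \<sigma> \<tau>"
    and sol: "strict_solution (incidences v F) lam A S B"
  shows "certifies_inscribability A P"
proof -
  interpret cyclic_sdp "incidences v F" lam "CARD('n)" \<sigma> \<tau> by fact
  have opt: "sdp_optimal (incidences v F) lam A S B"
    and pos: "\<And>i j. (i, j) \<notin> incidences v F \<Longrightarrow> 0 < S $ i $ j"
    using sol by (auto simp: strict_solution_def)
  have feas: "sdp_feasible (incidences v F) A S B" using opt by (simp add: sdp_optimal_def)
  obtain w :: "'n \<Rightarrow> real^2" and u :: "'m \<Rightarrow> real^2"
    where unit: "\<And>i. norm (w i) = 1" and A: "\<And>i k. A $ i $ k = 1 + w i \<bullet> w k"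
      and S: "\<And>i j. S $ i $ j = 1 + w i \<bullet> u j"
    using attained_imp_planar[OF feas optimal_value[OF opt]] by blast
  have "combinatorially_equivalent P (convex hull range w)"
  proof (rule inscribed_polygon_equivalent[OF n P v F unit])
    show "w i \<bullet> u j = -1" if "v i \<in> F j" for i j
    proof -
      have "S $ i $ j = 0" using feas that by (auto simp: sdp_feasible_def incidences_def)
      then show ?thesis by (simp add: S)
    qed
    show "-1 < w i \<bullet> u j" if "v i \<notin> F j" for i j
      using pos[of i j] that by (simp add: S incidences_def)
  qed
  then show ?thesis
    unfolding certifies_inscribability_def
    using A unit convex_hull_unit_vectors_vertices[of w] by blast
qed

lemma certifies_imp_inscribable:
  fixes A :: "real^'n::finite^'n"
  assumes "certifies_inscribability A P"
  shows "inscribable P"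
proof -
  obtain w :: "'n \<Rightarrow> 'a" where unit: "\<And>i. norm (w i) = 1"
    and V: "vertices (convex hull range w) = range w"
    and eq: "combinatorially_equivalent P (convex hull range w)"
    using assms unfolding certifies_inscribability_def by blast
  have "vertices (convex hull range w) \<subseteq> sphere 0 1" using V unit by (auto simp: dist_norm)
  moreover have "polytope (convex hull range w)" by (simp add: polytope_convex_hull)
  ultimately show ?thesis unfolding inscribable_def using eq zero_less_one by blast
qed

theorem theorem2:
  fixes P :: "(real^2) set"
    and v :: "'n::finite \<Rightarrow> real^2"
    and F :: "'m::finite \<Rightarrow> (real^2) set"
    and lam :: "'n \<Rightarrow> 'm \<Rightarrow> real"
  assumes "CARD('n) \<ge> 3"
    and "polygon_with CARD('n) P"
    and "bij_betw v UNIV (vertices P)"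
    and "bij_betw F UNIV (facets P)"
    and "\<And>i j. (i, j) \<notin> incidences v F \<Longrightarrow>
           lam i j = 2 / real CARD('n) * (1 / cos (pi / real CARD('n)))\<^sup>2"
  shows "CARD('m) = CARD('n) \<and>
         (\<exists>A S B. strict_solution (incidences v F) lam A S B) \<and>
         (\<forall>A S B. strict_solution (incidences v F) lam A S B \<longrightarrow> certifies_inscribability A P) \<and>
         inscribable P"
proof -
  obtain \<sigma> :: "nat \<Rightarrow> 'n" and \<tau> :: "nat \<Rightarrow> 'm" where \<sigma>: "bij_betw \<sigma> {..<CARD('n)} UNIV" and \<tau>: "bij_betw \<tau> {..<CARD('n)} UNIV"
    and inc: "\<And>i k. i < CARD('n) \<Longrightarrow> k < CARD('n) \<Longrightarrow> v (\<sigma> i) \<in> F (\<tau> k) \<longleftrightarrow> i = k \<or> i = Suc k mod CARD('n)"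
    using polygon_labelling[OF refl assms(1-4)] by blast
  have cyc: "cyclic_sdp (incidences v F) lam CARD('n) \<sigma> \<tau>"
    using assms(1) \<sigma> \<tau> inc assms(5) by unfold_locales (auto simp: incidences_def)
  have ex: "\<exists>A S B. strict_solution (incidences v F) lam A S B"
    using cyc by (rule cyclic_sdp.strict_solution_exists)
  have cert: "\<forall>A S B. strict_solution (incidences v F) lam A S B \<longrightarrow> certifies_inscribability A P"
    using strict_solution_certifies[OF assms(1-4) cyc] by blast
  have "CARD('m) = CARD('n)" using bij_betw_same_card[OF \<tau>] by simp
  then show ?thesis using ex cert certifies_imp_inscribable by blast
qed

end
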